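(* Let $\Gamma$ be a discrete group and let $(A_n,\tau_n)$ be a sequence of unital tracial Banach algebras with $\sup_n\|\tau_n\|<\infty$. Let $\rho_n:\Gamma\to GL(A_n)$ be a sequence of unital maps satisfying $\|\rho_n(a)\rho_n(b)-\rho_n(ab)\|\to 0$ and $\sup_n\|\rho_n(a)\|<\infty$ for all $a,b\in\Gamma$. Then the formula $$\omega(a,b)=\left(\frac{1}{2\pi i}\tau_n\left(\log\left(\rho_n(a)\rho_n(b)\rho_n(ab)^{-1}\right)\right)\right)_n$$ defines a 2-cocycle $\omega\in Z^2(\Gamma,Q(\mathbb{C}))$. If there exists a sequence of group homomorphisms $\pi_n:\Gamma\to GL(A_n)$ such that $\|\rho_n(a)-\pi_n(a)\|\to 0$ for all $a\in\Gamma$, then $\omega$ is cohomologous to $0$, i.e. $[\rho]:=[\omega]=0$ in $H^2(\Gamma,Q(\mathbb{C}))$.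
   Context: A unital tracial Banach algebra $(A_n,\tau_n)$ is a unital complex Banach algebra $A_n$ with a continuous linear functional $\tau_n:A_n\to\mathbb{C}$ satisfying $\tau_n(xy)=\tau_n(yx)$. $GL(A_n)$ is the group of invertible elements; a map $\rho_n$ is unital if $\rho_n(e)=1_n$, the unit of $A_n$. For $\|u-1\|<1$, $\log(u)=-\sum_{k\ge1}(1-u)^k/k$. $Q(\mathbb{C})=c_0(\mathbb{N},\mathbb{C})/c_{00}(\mathbb{N},\mathbb{C})$, where $c_0$ denotes sequences converging to $0$ and $c_{00}$ finitely supported sequences; an element of $Q(\mathbb{C})$ is thus specified by the components of a null sequence for all sufficiently large $n$ (the finitely many components where the logarithm might be undefined are irrelevant). $Q(\mathbb{C})$ is a trivial $\Gamma$-module. $Z^2(\Gamma,Q)$ is the group of functions $\omega:\Gamma^2\to Q$ with $\omega(a,b)+\omega(ab,c)=\omega(a,bc)+\omega(b,c)$, and $H^2(\Gamma,Q)$ is its quotient by the coboundaries $\gamma(a)-\gamma(ab)+\gamma(b)$, $\gamma:\Gamma\to Q$. *)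

theory Defs
  imports "HOL-Analysis.Analysis" "HOL-Algebra.Algebra"
begin

section \<open>Banach algebras on a carrier set\<close>

text \<open>
  The algebras of a sequence are pairwise unrelated, so they are modelled with explicit
  carriers rather than by a type class. A sequence of algebras shares one type \<open>'a\<close> of
  representatives, which is no restriction: the carriers may be pairwise disjoint and the
  structure varies freely with the index.
\<close>

definition complex_ring :: "complex ring" where
  "complex_ring = \<lparr>carrier = UNIV, monoid.mult = (*), one = 1, ring.zero = 0, ring.add = (+)\<rparr>"

record 'a normed_alg = "(complex, 'a) module" +
  alg_norm :: "'a \<Rightarrow> real"

text \<open>
  The locale \<open>Metric_space\<close> demands symmetry and nonnegativity on the whole type; hence the
  default value off the carrier.
\<close>

definition alg_dist :: "('a, 'r) normed_alg_scheme \<Rightarrow> 'a \<Rightarrow> 'a \<Rightarrow> real" where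
  "alg_dist A x y =
     (if x \<in> carrier A \<and> y \<in> carrier A then alg_norm A (x \<ominus>\<^bsub>A\<^esub> y) else 0)"

abbreviation alg_topology :: "('a, 'r) normed_alg_scheme \<Rightarrow> 'a topology" where
  "alg_topology A \<equiv> Metric_space.mtopology (carrier A) (alg_dist A)"

text \<open>No normalisation of the norm of the unit is imposed.\<close>

locale unital_banach_algebra = ring A + module complex_ring A
  for A :: "('a, 'r) normed_alg_scheme" (structure) +
  assumes smult_mult_left: "\<lbrakk>x \<in> carrier A; y \<in> carrier A\<rbrakk> \<Longrightarrow> (c \<odot> x) \<otimes> y = c \<odot> (x \<otimes> y)"
    and smult_mult_right: "\<lbrakk>x \<in> carrier A; y \<in> carrier A\<rbrakk> \<Longrightarrow> x \<otimes> (c \<odot> y) = c \<odot> (x \<otimes> y)"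
    and norm_nonneg: "x \<in> carrier A \<Longrightarrow> 0 \<le> alg_norm A x"
    and norm_eq_zero_iff: "x \<in> carrier A \<Longrightarrow> alg_norm A x = 0 \<longleftrightarrow> x = \<zero>"
    and norm_triangle: "\<lbrakk>x \<in> carrier A; y \<in> carrier A\<rbrakk>
          \<Longrightarrow> alg_norm A (x \<oplus> y) \<le> alg_norm A x + alg_norm A y"
    and norm_smult: "x \<in> carrier A \<Longrightarrow> alg_norm A (c \<odot> x) = cmod c * alg_norm A x"
    and norm_submult: "\<lbrakk>x \<in> carrier A; y \<in> carrier A\<rbrakk>
          \<Longrightarrow> alg_norm A (x \<otimes> y) \<le> alg_norm A x * alg_norm A y"
    and complete: "Metric_space.mcomplete (carrier A) (alg_dist A)"

locale unital_tracial_banach_algebra = unital_banach_algebra A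
  for A :: "('a, 'r) normed_alg_scheme" (structure) +
  fixes \<tau> :: "'a \<Rightarrow> complex"
  assumes trace_add: "\<lbrakk>x \<in> carrier A; y \<in> carrier A\<rbrakk> \<Longrightarrow> \<tau> (x \<oplus> y) = \<tau> x + \<tau> y"
    and trace_smult: "x \<in> carrier A \<Longrightarrow> \<tau> (c \<odot> x) = c * \<tau> x"
    and trace_continuous: "continuous_map (alg_topology A) euclidean \<tau>"
    and trace_commute: "\<lbrakk>x \<in> carrier A; y \<in> carrier A\<rbrakk> \<Longrightarrow> \<tau> (x \<otimes> y) = \<tau> (y \<otimes> x)"

definition functional_norm :: "('a, 'r) normed_alg_scheme \<Rightarrow> ('a \<Rightarrow> complex) \<Rightarrow> real" where
  "functional_norm A \<phi> = (SUP x \<in> {x \<in> carrier A. alg_norm A x \<le> 1}. cmod (\<phi> x))"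

text \<open>Meaningful only if the series converges, in particular if \<open>alg_norm A (\<one>\<^bsub>A\<^esub> \<ominus>\<^bsub>A\<^esub> u) < 1\<close>.\<close>

definition alg_log :: "('a, 'r) normed_alg_scheme \<Rightarrow> 'a \<Rightarrow> 'a" where
  "alg_log A u = (THE l. limitin (alg_topology A)
     (\<lambda>N. \<ominus>\<^bsub>A\<^esub> (\<Oplus>\<^bsub>A\<^esub>k \<in> {1..N}. (1 / of_nat k) \<odot>\<^bsub>A\<^esub> ((\<one>\<^bsub>A\<^esub> \<ominus>\<^bsub>A\<^esub> u) [^]\<^bsub>A\<^esub> k)))
     l sequentially)"


section \<open>The coefficient group of null sequences modulo finitely supported ones\<close>

text \<open>
  Abelian groups of coefficients are written multiplicatively, following the conventions for
  groups and factor groups: the operation \<open>\<otimes>\<close> below is addition of sequences.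
\<close>

definition c0 :: "(nat \<Rightarrow> complex) monoid" where
  "c0 = \<lparr>carrier = {x. x \<longlonglongrightarrow> 0}, monoid.mult = (\<lambda>x y n. x n + y n), one = (\<lambda>n. 0)\<rparr>"

definition c00 :: "(nat \<Rightarrow> complex) set" where
  "c00 = {x. finite {n. x n \<noteq> 0}}"

definition QC :: "(nat \<Rightarrow> complex) set monoid" where
  "QC = c0 Mod c00"

text \<open>
  A sequence outside \<open>c0\<close> yields a set that is not in \<open>carrier QC\<close>; sequences differing in
  finitely many components yield the same set.
\<close>

definition QC_class :: "(nat \<Rightarrow> complex) \<Rightarrow> (nat \<Rightarrow> complex) set" where
  "QC_class x = c00 #>\<^bsub>c0\<^esub> x"


section \<open>Second cohomology with trivial coefficients\<close>

definition Z2 :: "('g, 'm) monoid_scheme \<Rightarrow> ('q, 'n) monoid_scheme \<Rightarrow> ('g \<times> 'g \<Rightarrow> 'q) monoid" where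
  "Z2 G Q =
     \<lparr>carrier = {\<omega> \<in> carrier G \<times> carrier G \<rightarrow>\<^sub>E carrier Q.
        \<forall>a \<in> carrier G. \<forall>b \<in> carrier G. \<forall>c \<in> carrier G.
          \<omega> (a, b) \<otimes>\<^bsub>Q\<^esub> \<omega> (a \<otimes>\<^bsub>G\<^esub> b, c) = \<omega> (a, b \<otimes>\<^bsub>G\<^esub> c) \<otimes>\<^bsub>Q\<^esub> \<omega> (b, c)},
      monoid.mult = (\<lambda>\<omega> \<omega>'. \<lambda>p \<in> carrier G \<times> carrier G. \<omega> p \<otimes>\<^bsub>Q\<^esub> \<omega>' p),
      one = (\<lambda>p \<in> carrier G \<times> carrier G. \<one>\<^bsub>Q\<^esub>)\<rparr>"

definition coboundary ::
    "('g, 'm) monoid_scheme \<Rightarrow> ('q, 'n) monoid_scheme \<Rightarrow> ('g \<Rightarrow> 'q) \<Rightarrow> 'g \<times> 'g \<Rightarrow> 'q" where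
  "coboundary G Q \<gamma> = (\<lambda>(a, b) \<in> carrier G \<times> carrier G.
     \<gamma> a \<otimes>\<^bsub>Q\<^esub> inv\<^bsub>Q\<^esub> \<gamma> (a \<otimes>\<^bsub>G\<^esub> b) \<otimes>\<^bsub>Q\<^esub> \<gamma> b)"

definition B2 :: "('g, 'm) monoid_scheme \<Rightarrow> ('q, 'n) monoid_scheme \<Rightarrow> ('g \<times> 'g \<Rightarrow> 'q) set" where
  "B2 G Q = coboundary G Q ` (carrier G \<rightarrow> carrier Q)"

definition H2 ::
    "('g, 'm) monoid_scheme \<Rightarrow> ('q, 'n) monoid_scheme \<Rightarrow> ('g \<times> 'g \<Rightarrow> 'q) set monoid" where
  "H2 G Q = Z2 G Q Mod B2 G Q"

definition H2_class ::
    "('g, 'm) monoid_scheme \<Rightarrow> ('q, 'n) monoid_scheme \<Rightarrow> ('g \<times> 'g \<Rightarrow> 'q) \<Rightarrow> ('g \<times> 'g \<Rightarrow> 'q) set" where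
  "H2_class G Q \<omega> = B2 G Q #>\<^bsub>Z2 G Q\<^esub> \<omega>"


section \<open>The cocycle of an asymptotic homomorphism\<close>

definition mult_defect ::
    "('g, 'm) monoid_scheme \<Rightarrow> ('a, 'r) normed_alg_scheme \<Rightarrow> ('g \<Rightarrow> 'a) \<Rightarrow> 'g \<Rightarrow> 'g \<Rightarrow> 'a" where
  "mult_defect G A \<rho> a b = \<rho> a \<otimes>\<^bsub>A\<^esub> \<rho> b \<otimes>\<^bsub>A\<^esub> inv\<^bsub>A\<^esub> (\<rho> (a \<otimes>\<^bsub>G\<^esub> b))"

definition asymp_cocycle ::
    "('g, 'm) monoid_scheme \<Rightarrow> (nat \<Rightarrow> ('a, 'r) normed_alg_scheme) \<Rightarrow> (nat \<Rightarrow> 'a \<Rightarrow> complex)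
      \<Rightarrow> (nat \<Rightarrow> 'g \<Rightarrow> 'a) \<Rightarrow> 'g \<times> 'g \<Rightarrow> (nat \<Rightarrow> complex) set" where
  "asymp_cocycle G A \<tau> \<rho> = (\<lambda>(a, b) \<in> carrier G \<times> carrier G.
     QC_class (\<lambda>n. 1 / (2 * of_real pi * \<i>) * \<tau> n (alg_log (A n) (mult_defect G (A n) (\<rho> n) a b))))"

end

theory Submission
  imports Defs
begin

text \<open>
  The heart of the matter is that \<open>\<tau> (log (u v)) = \<tau> (log u) + \<tau> (log v)\<close> for \<open>u\<close>, \<open>v\<close> close
  to the unit, and that \<open>\<tau> (log u)\<close> is invariant under conjugation. Although \<open>log\<close> is not additive
  on noncommuting elements, its trace has derivative \<open>h \<mapsto> \<tau> (u\<^sup>-\<^sup>1 h)\<close> at \<open>u\<close>. Hence, along the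
  segment \<open>p\<^sub>t\<close> from the unit to \<open>u\<close>, the functions \<open>\<tau> (log (p\<^sub>t v))\<close> and \<open>\<tau> (log p\<^sub>t)\<close> have equal
  derivatives, by the trace property.

  Write \<open>D(a, b) = \<rho>(a) \<rho>(b) \<rho>(ab)\<^sup>-\<^sup>1\<close>, which tends to the unit because \<open>\<rho>(a)\<^sup>-\<^sup>1\<close> stays bounded. The
  cocycle identity is the trace logarithm of
  \<open>D(a, b) D(ab, c) = (\<rho>(a) D(b, c) \<rho>(a)\<^sup>-\<^sup>1) D(a, bc)\<close>. Given homomorphisms \<open>\<pi>\<close> close to \<open>\<rho>\<close>, put
  \<open>Y(a) = \<rho>(a) \<pi>(a)\<^sup>-\<^sup>1\<close>; the trace logarithm of \<open>D(a, b) Y(ab) = Y(a) (\<pi>(a) Y(b) \<pi>(a)\<^sup>-\<^sup>1)\<close>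
  exhibits the cocycle as the coboundary of the class of \<open>\<tau> (log Y) / (2 \<pi> i)\<close>.
\<close>

section \<open>Unital Banach algebras\<close>

lemma complex_ring_simps [simp]:
  "carrier complex_ring = UNIV" "x \<oplus>\<^bsub>complex_ring\<^esub> y = x + y"
  "x \<otimes>\<^bsub>complex_ring\<^esub> y = x * y" "\<one>\<^bsub>complex_ring\<^esub> = 1" "\<zero>\<^bsub>complex_ring\<^esub> = 0"
  by (simp_all add: complex_ring_def)

section \<open>Norm rules and the metric of the norm\<close>

context unital_banach_algebra
begin

lemma ring_A: "ring A"
  by unfold_locales

lemmas alg_simps = ring.ring_simprules[OF ring_A]
lemmas alg_closed = alg_simps(1-6)
lemmas alg_one_mult = alg_simps(12)
lemmas alg_minus_eq = alg_simps(14)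

lemmas nat_pow_simps = monoid.nat_pow_Suc[OF ring.axioms(2)[OF ring_A]]
  monoid.nat_pow_0[OF ring.axioms(2)[OF ring_A]]

lemma monoid_A: "monoid A"
  using ring.axioms(2)[OF ring_A] .

lemma pow_closed [simp, intro]: "a \<in> carrier A \<Longrightarrow> a [^] (k::nat) \<in> carrier A"
  by (rule monoid.nat_pow_closed[OF monoid_A])

lemma smult_in_carrier [simp, intro]: "x \<in> carrier A \<Longrightarrow> c \<odot> x \<in> carrier A"
  by simp

lemma smult_minus_one: "x \<in> carrier A \<Longrightarrow> (-1) \<odot> x = \<ominus> x"
proof -
  assume x: "x \<in> carrier A"
  have "x \<oplus> (-1) \<odot> x = 1 \<odot> x \<oplus> (-1) \<odot> x"
    using smult_one[OF x] by simp
  also have "\<dots> = 0 \<odot> x"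
    using smult_l_distr[of 1 "-1" x] x by simp
  also have "\<dots> = \<zero>"
    using smult_l_null[OF x] by simp
  finally have z: "x \<oplus> (-1) \<odot> x = \<zero>" .
  have "(-1) \<odot> x = \<ominus> x \<oplus> (x \<oplus> (-1) \<odot> x)"
    using x smult_in_carrier[OF x, of "-1"] by (simp add: alg_simps)
  then show ?thesis
    using x z by (simp add: alg_simps)
qed

lemma norm_zero [simp]: "alg_norm A \<zero> = 0"
  using norm_eq_zero_iff by simp

lemma norm_uminus: "x \<in> carrier A \<Longrightarrow> alg_norm A (\<ominus> x) = alg_norm A x"
  using norm_smult[of x "-1"] by (simp add: smult_minus_one)

lemma norm_minus_commute:
  "x \<in> carrier A \<Longrightarrow> y \<in> carrier A \<Longrightarrow> alg_norm A (x \<ominus> y) = alg_norm A (y \<ominus> x)"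
  using norm_uminus[of "x \<ominus> y"] by (simp add: alg_simps)

lemma norm_diff_triangle:
  assumes "x \<in> carrier A" "y \<in> carrier A" "z \<in> carrier A"
  shows "alg_norm A (x \<ominus> z) \<le> alg_norm A (x \<ominus> y) + alg_norm A (y \<ominus> z)"
proof -
  have "x \<ominus> z = (x \<ominus> y) \<oplus> (y \<ominus> z)"
    using assms by (simp add: alg_simps)
  then show ?thesis
    using norm_triangle[of "x \<ominus> y" "y \<ominus> z"] assms by simp
qed

sublocale metric: Metric_space "carrier A" "alg_dist A"
proof
  fix x y z
  show "0 \<le> alg_dist A x y"
    by (simp add: alg_dist_def norm_nonneg)
  show "alg_dist A x y = alg_dist A y x"
    by (simp add: alg_dist_def norm_minus_commute)
  assume xy: "x \<in> carrier A" "y \<in> carrier A"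
  then show "alg_dist A x y = 0 \<longleftrightarrow> x = y"
    by (simp add: alg_dist_def norm_eq_zero_iff)
  assume "z \<in> carrier A"
  with xy show "alg_dist A x z \<le> alg_dist A x y + alg_dist A y z"
    by (simp add: alg_dist_def norm_diff_triangle)
qed

lemma limitin_iff_norm:
  assumes "\<And>n. f n \<in> carrier A"
  shows "limitin (alg_topology A) f l sequentially \<longleftrightarrow>
    l \<in> carrier A \<and> (\<lambda>n. alg_norm A (f n \<ominus> l)) \<longlonglongrightarrow> 0"
proof -
  have "l \<in> carrier A \<Longrightarrow> (\<lambda>n. alg_dist A (f n) l) = (\<lambda>n. alg_norm A (f n \<ominus> l))"
    using assms by (simp add: alg_dist_def)
  then show ?thesis
    using assms by (auto simp: metric.limitin_metric_dist_null)
qed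

text \<open>The factor \<open>h\<close> makes the bound hold at \<open>k = 0\<close> as well: the
  norm of the unit is not normalised, so \<open>a [^] 0\<close> alone need not have norm at most
  1.\<close>

lemma norm_pow_mult:
  assumes "a \<in> carrier A" "h \<in> carrier A"
  shows "alg_norm A (a [^] (k::nat) \<otimes> h) \<le> alg_norm A a ^ k * alg_norm A h"
proof (induction k)
  case 0
  show ?case
    using assms by (simp add: alg_simps nat_pow_simps)
next
  case (Suc k)
  have "a [^] Suc k \<otimes> h = a \<otimes> (a [^] k \<otimes> h)"
    unfolding monoid.nat_pow_Suc2[OF monoid_A assms(1)] using assms
    by (simp add: alg_simps)
  then have "alg_norm A (a [^] Suc k \<otimes> h) \<le> alg_norm A a * alg_norm A (a [^] k \<otimes> h)"
    using norm_submult[of a "a [^] k \<otimes> h"] assms by (simp add: alg_simps)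
  also have "\<dots> \<le> alg_norm A a * (alg_norm A a ^ k * alg_norm A h)"
    using Suc assms by (intro mult_left_mono) (auto simp: norm_nonneg)
  finally show ?case
    by (simp add: mult_ac)
qed

lemma norm_pow_Suc:
  assumes "a \<in> carrier A"
  shows "alg_norm A (a [^] Suc k) \<le> alg_norm A a ^ Suc k"
  using norm_pow_mult[of a a k] assms by (simp add: nat_pow_simps mult_ac)

section \<open>Absolutely convergent series and the Neumann series\<close>

lemma finsum_Icc_Suc:
  fixes f :: "nat \<Rightarrow> 'a"
  assumes "\<And>k. f k \<in> carrier A"
  shows "(\<Oplus>k\<in>{1..Suc N}. f k) = f (Suc N) \<oplus> (\<Oplus>k\<in>{1..N}. f k)"
proof -
  have "{1..Suc N} = insert (Suc N) {1..N}" by auto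
  then show ?thesis
    using abelian_monoid.finsum_insert[of A "{1..N}" "Suc N" f] assms
    by (simp add: ring.is_abelian_group[OF ring_A] abelian_group.axioms(1))
qed

lemma finsum_Icc_closed:
  fixes f :: "nat \<Rightarrow> 'a"
  assumes "\<And>k. f k \<in> carrier A"
  shows "(\<Oplus>k\<in>{1..N}. f k) \<in> carrier A"
  using assms by (intro abelian_monoid.finsum_closed abelian_group.axioms(1)
      ring.is_abelian_group ring_A) auto

text \<open>Distances between partial sums are dominated by those between partial sums of
  \<open>g\<close>, so completeness applies. The bound is asked from index 1 on, which is where the
  geometric bound on powers starts.\<close>

lemma absolutely_convergent_imp_convergent:
  fixes f :: "nat \<Rightarrow> 'a"
  assumes f: "\<And>k. f k \<in> carrier A"
    and g: "\<And>k. k \<ge> 1 \<Longrightarrow> alg_norm A (f k) \<le> g k" and "summable g"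
  obtains l where "limitin (alg_topology A) (\<lambda>N. \<Oplus>k\<in>{1..N}. f k) l sequentially"
proof -
  define S where "S = (\<lambda>N. \<Oplus>k\<in>{1..N}. f k)"
  have S: "S N \<in> carrier A" for N
    unfolding S_def by (rule finsum_Icc_closed[OF f])
  have SSuc: "S (Suc N) = f (Suc N) \<oplus> S N" for N
    unfolding S_def by (rule finsum_Icc_Suc[OF f])
  \<comment> \<open>The sums of \<open>g\<close> begin at index 0, those of \<open>f\<close> at 1;
    the extra term \<open>g 0\<close> cancels in the difference.\<close>
  have le: "alg_norm A (S (m + d) \<ominus> S m) \<le> sum g {..m + d} - sum g {..m}" for m d
  proof (induction d)
    case 0
    show ?case using S by (simp add: alg_simps)
  next
    case (Suc d)
    have "S (m + Suc d) \<ominus> S m = f (Suc (m + d)) \<oplus> (S (m + d) \<ominus> S m)"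
      using S f by (simp add: SSuc alg_simps)
    then have "alg_norm A (S (m + Suc d) \<ominus> S m)
        \<le> alg_norm A (f (Suc (m + d))) + alg_norm A (S (m + d) \<ominus> S m)"
      using norm_triangle[of "f (Suc (m + d))" "S (m + d) \<ominus> S m"] S f by simp
    also have "\<dots> \<le> g (Suc (m + d)) + (sum g {..m + d} - sum g {..m})"
      using Suc g by (intro add_mono) auto
    finally show ?case by simp
  qed
  have le': "alg_dist A (S m) (S n) \<le> dist (sum g {..m}) (sum g {..n})" for m n
  proof (cases "m \<le> n")
    case True
    then show ?thesis
      using le[of m "n - m"] S by (simp add: alg_dist_def norm_minus_commute dist_real_def)
  next
    case False
    then show ?thesis
      using le[of n "m - n"] S by (simp add: alg_dist_def dist_real_def)
  qed
  have "Cauchy (\<lambda>n. sum g {..n})"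
    using \<open>summable g\<close> summable_LIMSEQ' convergent_Cauchy convergentI by blast
  then have "metric.MCauchy S"
    using S le' unfolding metric.MCauchy_def Cauchy_def
    by (meson image_subsetI le_less_trans)
  then show ?thesis
    using complete that unfolding metric.mcomplete_def S_def by blast
qed

text \<open>The inverse is the unit plus the sum of the powers of \<open>a\<close> with exponent at
  least 1. The power of exponent 0 is kept apart, since it does not obey the geometric norm
  bound.\<close>

lemma neumann_unit:
  assumes a: "a \<in> carrier A" and na: "alg_norm A a < 1"
  shows "\<one> \<ominus> a \<in> Units A"
proof -
  define S where "S = (\<lambda>N. \<Oplus>k\<in>{1..N}. a [^] (k::nat))"
  have S: "S N \<in> carrier A" for N
    using finsum_Icc_closed[of "\<lambda>k::nat. a [^] k" N] a by (simp add: S_def)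
  have [simp]: "0 \<le> alg_norm A a" using a by (rule norm_nonneg)
  have "alg_norm A (a [^] k) \<le> alg_norm A a ^ k" if "k \<ge> 1" for k
    using that norm_pow_Suc[OF a, of "k - 1"] by simp
  moreover have "summable (\<lambda>k. alg_norm A a ^ k)"
    using na by (intro summable_geometric) simp
  ultimately obtain s where "limitin (alg_topology A) S s sequentially"
    unfolding S_def using absolutely_convergent_imp_convergent[of "\<lambda>k. a [^] k"] a by blast
  then have s: "s \<in> carrier A" and lim: "(\<lambda>n. alg_norm A (S n \<ominus> s)) \<longlonglongrightarrow> 0"
    using S by (auto simp: limitin_iff_norm)
  \<comment> \<open>Both orders are telescoped, since an inverse in a noncommutative algebra has to
    be checked on both sides.\<close>
  have tele: "(\<one> \<ominus> a) \<otimes> (\<one> \<oplus> S N) = \<one> \<ominus> a [^] Suc N \<and> (\<one> \<oplus> S N) \<otimes> (\<one> \<ominus> a) = \<one> \<ominus> a [^] Suc N" for N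
  proof (induction N)
    case 0
    show ?case using a by (simp add: S_def alg_simps nat_pow_simps)
  next
    case (Suc N)
    have SS: "S (Suc N) = a [^] Suc N \<oplus> S N"
      unfolding S_def by (rule finsum_Icc_Suc) (use a in simp)
    have p: "a [^] Suc N \<in> carrier A" using a by simp
    have "(\<one> \<ominus> a) \<otimes> (\<one> \<oplus> S (Suc N)) = (\<one> \<ominus> a) \<otimes> a [^] Suc N \<oplus> (\<one> \<ominus> a) \<otimes> (\<one> \<oplus> S N)"
      using S a p by (simp add: SS alg_simps)
    moreover have "(\<one> \<oplus> S (Suc N)) \<otimes> (\<one> \<ominus> a) = a [^] Suc N \<otimes> (\<one> \<ominus> a) \<oplus> (\<one> \<oplus> S N) \<otimes> (\<one> \<ominus> a)"
      using S a p by (simp add: SS alg_simps)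
    moreover have "a [^] Suc (Suc N) = a \<otimes> a [^] Suc N" "a [^] Suc (Suc N) = a [^] Suc N \<otimes> a"
      using a monoid.nat_pow_Suc2[OF monoid_A a, of "Suc N"] by (simp_all add: nat_pow_simps)
    ultimately show ?case using Suc a p
      by (simp add: alg_simps del: nat_pow_Suc)
  qed
  have pw: "(\<lambda>N. alg_norm A a ^ Suc N) \<longlonglongrightarrow> 0"
    using na by (intro LIMSEQ_Suc LIMSEQ_power_zero) simp
  have lim': "(\<lambda>N. alg_norm A (\<one> \<ominus> a) * alg_norm A (S N \<ominus> s) + alg_norm A a ^ Suc N) \<longlonglongrightarrow> 0"
    using tendsto_add[OF tendsto_mult_left[OF lim] pw] by simp
  \<comment> \<open>The left side does not depend on \<open>N\<close>, while the bound, made of the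
    distance from \<open>S N\<close> to \<open>s\<close> and the telescoping remainder, tends to
    0.\<close>
  have "alg_norm A ((\<one> \<ominus> a) \<otimes> (\<one> \<oplus> s) \<ominus> \<one>) \<le> 0"
  proof (rule LIMSEQ_le_const[OF lim'], intro exI allI impI)
    fix N
    have p: "a [^] Suc N \<in> carrier A" using a by simp
    have "(\<one> \<ominus> a) \<otimes> (\<one> \<oplus> s) \<ominus> \<one> = (\<one> \<ominus> a) \<otimes> (\<one> \<oplus> S N) \<ominus> (\<one> \<ominus> a) \<otimes> (S N \<ominus> s) \<ominus> \<one>"
      using a s S[of N] one_closed by algebra
    also have "\<dots> = \<ominus> ((\<one> \<ominus> a) \<otimes> (S N \<ominus> s) \<oplus> a [^] Suc N)"
      using conjunct1[OF tele[of N]] a s S p by (simp add: alg_simps del: nat_pow_Suc)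
    finally have "alg_norm A ((\<one> \<ominus> a) \<otimes> (\<one> \<oplus> s) \<ominus> \<one>) = alg_norm A ((\<one> \<ominus> a) \<otimes> (S N \<ominus> s) \<oplus> a [^] Suc N)"
      using a s S p by (simp add: norm_uminus del: nat_pow_Suc)
    also have "\<dots> \<le> alg_norm A ((\<one> \<ominus> a) \<otimes> (S N \<ominus> s)) + alg_norm A (a [^] Suc N)"
      using a s S p by (intro norm_triangle) auto
    also have "\<dots> \<le> alg_norm A (\<one> \<ominus> a) * alg_norm A (S N \<ominus> s) + alg_norm A a ^ Suc N"
      using a s S by (intro add_mono norm_submult norm_pow_Suc) auto
    finally show "alg_norm A ((\<one> \<ominus> a) \<otimes> (\<one> \<oplus> s) \<ominus> \<one>) \<le> \<dots>" .
  qed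
  then have 1: "(\<one> \<ominus> a) \<otimes> (\<one> \<oplus> s) = \<one>"
    using norm_eq_zero_iff[of "(\<one> \<ominus> a) \<otimes> (\<one> \<oplus> s) \<ominus> \<one>"] norm_nonneg[of "(\<one> \<ominus> a) \<otimes> (\<one> \<oplus> s) \<ominus> \<one>"] a s
    by simp
  have "alg_norm A ((\<one> \<oplus> s) \<otimes> (\<one> \<ominus> a) \<ominus> \<one>) \<le> 0"
  proof (rule LIMSEQ_le_const[OF lim'], intro exI allI impI)
    fix N
    have p: "a [^] Suc N \<in> carrier A" using a by simp
    have "(\<one> \<oplus> s) \<otimes> (\<one> \<ominus> a) \<ominus> \<one> = (\<one> \<oplus> S N) \<otimes> (\<one> \<ominus> a) \<ominus> (S N \<ominus> s) \<otimes> (\<one> \<ominus> a) \<ominus> \<one>"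
      using a s S[of N] one_closed by algebra
    also have "\<dots> = \<ominus> ((S N \<ominus> s) \<otimes> (\<one> \<ominus> a) \<oplus> a [^] Suc N)"
      using conjunct2[OF tele[of N]] a s S p by (simp add: alg_simps del: nat_pow_Suc)
    finally have "alg_norm A ((\<one> \<oplus> s) \<otimes> (\<one> \<ominus> a) \<ominus> \<one>) = alg_norm A ((S N \<ominus> s) \<otimes> (\<one> \<ominus> a) \<oplus> a [^] Suc N)"
      using a s S p by (simp add: norm_uminus del: nat_pow_Suc)
    also have "\<dots> \<le> alg_norm A ((S N \<ominus> s) \<otimes> (\<one> \<ominus> a)) + alg_norm A (a [^] Suc N)"
      using a s S p by (intro norm_triangle) auto
    also have "\<dots> \<le> alg_norm A (\<one> \<ominus> a) * alg_norm A (S N \<ominus> s) + alg_norm A a ^ Suc N"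
      using a s S norm_submult[of "S N \<ominus> s" "\<one> \<ominus> a"]
      by (intro add_mono norm_pow_Suc) (auto simp: mult.commute)
    finally show "alg_norm A ((\<one> \<oplus> s) \<otimes> (\<one> \<ominus> a) \<ominus> \<one>) \<le> \<dots>" .
  qed
  then have 2: "(\<one> \<oplus> s) \<otimes> (\<one> \<ominus> a) = \<one>"
    using norm_eq_zero_iff[of "(\<one> \<oplus> s) \<otimes> (\<one> \<ominus> a) \<ominus> \<one>"] norm_nonneg[of "(\<one> \<oplus> s) \<otimes> (\<one> \<ominus> a) \<ominus> \<one>"] a s
    by simp
  show ?thesis
    unfolding Units_def using 1 2 a s by auto
qed

end

section \<open>Traces and the logarithm\<close>

text \<open>The derivative of the k-th power at \<open>a\<close> in direction \<open>h\<close>, that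
  is, the sum of \<open>a [^] i \<otimes> h \<otimes> a [^] (k - 1 - i)\<close> over
  \<open>i < k\<close>. The recursion is the product rule for
  \<open>a [^] k \<otimes> a\<close>.\<close>

primrec (in unital_banach_algebra) pow_deriv :: "'a \<Rightarrow> 'a \<Rightarrow> nat \<Rightarrow> 'a" where
  "pow_deriv a h 0 = \<zero>"
| "pow_deriv a h (Suc k) = pow_deriv a h k \<otimes> a \<oplus> a [^] k \<otimes> h"

section \<open>Lipschitz and Taylor estimates for powers\<close>

context unital_banach_algebra
begin

lemma pow_deriv_closed [simp]:
  "a \<in> carrier A \<Longrightarrow> h \<in> carrier A \<Longrightarrow> pow_deriv a h k \<in> carrier A"
  by (induction k) (auto simp: alg_simps)

text \<open>Telescoping the difference gives k terms, each of size at most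
  \<open>(1/2) ^ (k - 1)\<close> times the distance; the factor 2 avoids the exponent
  \<open>k - 1\<close>.\<close>

lemma norm_pow_diff_le:
  assumes a: "a \<in> carrier A" and b: "b \<in> carrier A"
    and na: "alg_norm A a \<le> 1/2" and nb: "alg_norm A b \<le> 1/2"
  shows "alg_norm A (b [^] k \<ominus> a [^] k) \<le> 2 * real k * (1/2) ^ k * alg_norm A (b \<ominus> a)"
proof (induction k)
  case 0
  show ?case using a b by (simp add: alg_simps nat_pow_simps)
next
  case (Suc k)
  let ?h = "b \<ominus> a"
  have p: "a [^] k \<in> carrier A" "b [^] k \<in> carrier A" using a b by auto
  have "b [^] Suc k \<ominus> a [^] Suc k = (b [^] k \<ominus> a [^] k) \<otimes> b \<oplus> a [^] k \<otimes> ?h"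
    unfolding nat_pow_simps using a b p by algebra
  then have "alg_norm A (b [^] Suc k \<ominus> a [^] Suc k)
      \<le> alg_norm A ((b [^] k \<ominus> a [^] k) \<otimes> b) + alg_norm A (a [^] k \<otimes> ?h)"
    using a b p norm_triangle[of "(b [^] k \<ominus> a [^] k) \<otimes> b" "a [^] k \<otimes> ?h"]
    by (simp add: alg_closed)
  also have "alg_norm A ((b [^] k \<ominus> a [^] k) \<otimes> b) \<le> alg_norm A (b [^] k \<ominus> a [^] k) * alg_norm A b"
    using a b p by (intro norm_submult) (auto simp: alg_closed)
  also have "\<dots> \<le> (2 * real k * (1/2) ^ k * alg_norm A ?h) * (1/2)"
    using Suc nb a b p
    by (intro mult_mono) (auto intro!: norm_nonneg mult_nonneg_nonneg simp: alg_closed)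
  also have "alg_norm A (a [^] k \<otimes> ?h) \<le> alg_norm A a ^ k * alg_norm A ?h"
    using a b by (intro norm_pow_mult) (auto simp: alg_closed)
  also have "\<dots> \<le> (1/2) ^ k * alg_norm A ?h"
    using na a b by (intro mult_right_mono power_mono) (auto intro!: norm_nonneg simp: alg_closed)
  finally show ?case
    by (simp add: field_simps)
qed

text \<open>The quadratic factor in k is affordable: the logarithm divides the k-th power by k, and
  the remaining series still converges. In the induction the constant is closed by k^2 + k being at
  most (k + 1)^2.\<close>

lemma norm_pow_taylor_le:
  assumes a: "a \<in> carrier A" and b: "b \<in> carrier A"
    and na: "alg_norm A a \<le> 1/2" and nb: "alg_norm A b \<le> 1/2"
  shows "alg_norm A (b [^] k \<ominus> a [^] k \<ominus> pow_deriv a (b \<ominus> a) k)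
    \<le> 4 * (real k)\<^sup>2 * (1/2) ^ k * (alg_norm A (b \<ominus> a))\<^sup>2"
proof (induction k)
  case 0
  show ?case using a b by (simp add: alg_simps nat_pow_simps)
next
  case (Suc k)
  define h where "h = b \<ominus> a"
  define d where "d = pow_deriv a h k"
  have h: "h \<in> carrier A" using a b by (simp add: h_def alg_simps)
  have d: "d \<in> carrier A" using a h by (simp add: d_def)
  have p: "a [^] k \<in> carrier A" "b [^] k \<in> carrier A" using a b by auto
  have b_eq: "b = a \<oplus> h" unfolding h_def using a b by algebra
  have [simp]: "0 \<le> alg_norm A h" by (rule norm_nonneg[OF h])
  define r where "r = b [^] k \<ominus> a [^] k \<ominus> d"
  define e where "e = b [^] k \<ominus> a [^] k"
  have re: "r \<in> carrier A" "e \<in> carrier A" using p d by (auto simp: r_def e_def alg_simps)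
  have "b [^] Suc k \<ominus> a [^] Suc k \<ominus> pow_deriv a h (Suc k)
      = b [^] k \<otimes> (a \<oplus> h) \<ominus> a [^] k \<otimes> a \<ominus> (d \<otimes> a \<oplus> a [^] k \<otimes> h)"
    using b_eq by (simp add: nat_pow_simps d_def)
  \<comment> \<open>The new remainder splits into the old remainder times \<open>a\<close> and the
    first-order difference times \<open>h\<close>; the second product is already quadratic in
    \<open>h\<close>.\<close>
  also have "\<dots> = r \<otimes> a \<oplus> e \<otimes> h"
    unfolding r_def e_def using a h p d by algebra
  finally have "alg_norm A (b [^] Suc k \<ominus> a [^] Suc k \<ominus> pow_deriv a h (Suc k))
      \<le> alg_norm A (r \<otimes> a) + alg_norm A (e \<otimes> h)"
    using a h re norm_triangle[of "r \<otimes> a" "e \<otimes> h"] by (simp add: alg_closed)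
  also have "alg_norm A (r \<otimes> a) \<le> alg_norm A r * alg_norm A a"
    using a re by (intro norm_submult)
  also have "\<dots> \<le> (4 * (real k)\<^sup>2 * (1/2) ^ k * (alg_norm A h)\<^sup>2) * (1/2)"
    using Suc na a re unfolding r_def d_def h_def
    by (intro mult_mono) (auto intro!: norm_nonneg simp: alg_closed)
  also have "alg_norm A (e \<otimes> h) \<le> alg_norm A e * alg_norm A h"
    using h re by (intro norm_submult)
  also have "\<dots> \<le> (2 * real k * (1/2) ^ k * alg_norm A h) * alg_norm A h"
    using norm_pow_diff_le[OF a b na nb, of k] unfolding e_def h_def[symmetric]
    by (intro mult_right_mono) auto
  also have "4 * (real k)\<^sup>2 * (1/2) ^ k * (alg_norm A h)\<^sup>2 * (1/2)
      + 2 * real k * (1/2) ^ k * alg_norm A h * alg_norm A h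
      = 4 * ((real k)\<^sup>2 + real k) * (1/2) ^ Suc k * (alg_norm A h)\<^sup>2"
    by (simp add: field_simps power2_eq_square)
  also have "\<dots> \<le> 4 * (real (Suc k))\<^sup>2 * (1/2) ^ Suc k * (alg_norm A h)\<^sup>2"
    by (intro mult_right_mono mult_left_mono) (auto simp: power2_eq_square algebra_simps)
  finally show ?case by (simp only: h_def)
qed

end

section \<open>Bounded traces and the series of the trace logarithm\<close>

context unital_tracial_banach_algebra
begin

lemma trace_zero [simp]: "\<tau> \<zero> = 0"
  using trace_add[of \<zero> \<zero>] by (simp add: alg_simps)

lemma trace_uminus: "x \<in> carrier A \<Longrightarrow> \<tau> (\<ominus> x) = - \<tau> x"
  using trace_smult[of x "-1"] by (simp add: smult_minus_one)

lemma trace_minus: "x \<in> carrier A \<Longrightarrow> y \<in> carrier A \<Longrightarrow> \<tau> (x \<ominus> y) = \<tau> x - \<tau> y"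
  by (simp add: alg_minus_eq trace_add trace_uminus alg_closed)

lemma trace_tendsto:
  assumes "\<And>n. f n \<in> carrier A" "l \<in> carrier A" "(\<lambda>n. alg_norm A (f n \<ominus> l)) \<longlonglongrightarrow> 0"
  shows "(\<lambda>n. \<tau> (f n)) \<longlonglongrightarrow> \<tau> l"
proof -
  have "limitin (alg_topology A) f l sequentially"
    using assms by (simp add: limitin_iff_norm)
  from continuous_map_limit[OF trace_continuous this] show ?thesis
    by (simp add: o_def)
qed

text \<open>Without this bound the supremum in \<open>functional_norm\<close> would carry no
  information. It comes from continuity at zero.\<close>

lemma trace_bdd_above: "bdd_above ((\<lambda>x. cmod (\<tau> x)) ` {x \<in> carrier A. alg_norm A x \<le> 1})"
proof (rule ccontr)
  assume "\<not> ?thesis"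
  then have "\<exists>x \<in> carrier A. alg_norm A x \<le> 1 \<and> real (Suc n) < cmod (\<tau> x)" for n
    by (force simp: bdd_above_def not_le)
  then obtain x where x: "\<And>n. x n \<in> carrier A" "\<And>n. alg_norm A (x n) \<le> 1"
      "\<And>n. real (Suc n) < cmod (\<tau> (x n))"
    by metis
  \<comment> \<open>Rescaling turns unboundedness into a null sequence whose traces have modulus at
    least 1.\<close>
  define y where "y n = (1 / of_nat (Suc n)) \<odot> x n" for n
  have y: "y n \<in> carrier A" for n using x by (simp add: y_def del: of_nat_Suc)
  have ny: "alg_norm A (y n) \<le> 1 / real (Suc n)" for n
    using x[of n] norm_smult[OF x(1), of "1 / of_nat (Suc n)" n]
    by (simp add: y_def norm_divide divide_right_mono del: of_nat_Suc)
  have "(\<lambda>n. alg_norm A (y n \<ominus> \<zero>)) \<longlonglongrightarrow> 0"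
  proof (rule Lim_null_comparison[OF _ LIMSEQ_Suc[OF lim_1_over_n]])
    show "\<forall>\<^sub>F n in sequentially. norm (alg_norm A (y n \<ominus> \<zero>)) \<le> 1 / real (Suc n)"
      using ny y by (simp add: norm_nonneg alg_simps)
  qed
  then have "(\<lambda>n. \<tau> (y n)) \<longlonglongrightarrow> 0"
    using trace_tendsto[of y \<zero>] y by simp
  then have "(\<lambda>n. cmod (\<tau> (y n))) \<longlonglongrightarrow> 0"
    by (rule tendsto_norm_zero)
  moreover have "1 \<le> cmod (\<tau> (y n))" for n
    using x(3)[of n] trace_smult[OF x(1), of "1 / of_nat (Suc n)" n]
    by (simp add: y_def norm_divide del: of_nat_Suc)
  ultimately have "(1::real) \<le> 0"
    by (intro LIMSEQ_le_const) auto
  then show False by simp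
qed

lemma functional_norm_upper:
  "x \<in> carrier A \<Longrightarrow> alg_norm A x \<le> 1 \<Longrightarrow> cmod (\<tau> x) \<le> functional_norm A \<tau>"
  unfolding functional_norm_def by (rule cSUP_upper[OF _ trace_bdd_above]) simp

lemma functional_norm_nonneg: "0 \<le> functional_norm A \<tau>"
  using functional_norm_upper[of \<zero>] by simp

lemma norm_trace_le:
  assumes x: "x \<in> carrier A"
  shows "cmod (\<tau> x) \<le> functional_norm A \<tau> * alg_norm A x"
proof (cases "alg_norm A x = 0")
  case True
  then show ?thesis using x by (simp add: norm_eq_zero_iff)
next
  case False
  then have pos: "0 < alg_norm A x" using norm_nonneg[OF x] by simp
  let ?y = "complex_of_real (1 / alg_norm A x) \<odot> x"
  have "alg_norm A ?y = 1"
    using pos by (simp add: norm_smult[OF x] norm_divide)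
  then have "cmod (\<tau> ?y) \<le> functional_norm A \<tau>"
    using functional_norm_upper[of ?y] x by simp
  then show ?thesis
    using pos by (simp add: trace_smult[OF x] norm_divide norm_mult field_simps)
qed

lemma trace_finsum_Icc:
  fixes f :: "nat \<Rightarrow> 'a"
  assumes "\<And>k. f k \<in> carrier A"
  shows "\<tau> (\<Oplus>k\<in>{1..N}. f k) = (\<Sum>k<N. \<tau> (f (Suc k)))"
proof (induction N)
  case 0
  have "(\<Oplus>k\<in>{}. f k) = \<zero>"
    by (rule abelian_monoid.finsum_empty)
      (intro abelian_group.axioms(1) ring.is_abelian_group ring_A)
  then show ?case by simp
next
  case (Suc N)
  show ?case
    using Suc assms by (simp add: finsum_Icc_Suc trace_add finsum_Icc_closed del: One_nat_def)
qed

text \<open>From here on the logarithm enters only through this scalar series. Uniqueness of metric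
  limits identifies the \<open>THE\<close> in \<open>alg_log\<close>, and continuity moves the trace
  inside the limit; \<open>Suc k\<close> shifts the sum to start at 0.\<close>

lemma trace_log_sums:
  assumes u: "u \<in> carrier A" and nu: "alg_norm A (\<one> \<ominus> u) < 1"
  shows "(\<lambda>k. - (\<tau> ((\<one> \<ominus> u) [^] Suc k) / of_nat (Suc k))) sums \<tau> (alg_log A u)"
proof -
  define a where "a = \<one> \<ominus> u"
  have a: "a \<in> carrier A" using u by (simp add: a_def alg_simps)
  have na0: "0 \<le> alg_norm A a" by (rule norm_nonneg[OF a])
  define f where "f = (\<lambda>k. (1 / of_nat k) \<odot> (a [^] (k::nat)))"
  have f: "f k \<in> carrier A" for k using a by (simp add: f_def)
  define S where "S = (\<lambda>N. \<Oplus>k\<in>{1..N}. f k)"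
  have S: "S N \<in> carrier A" for N unfolding S_def by (rule finsum_Icc_closed[OF f])
  have "alg_norm A (f k) \<le> alg_norm A a ^ k" if "k \<ge> 1" for k
  proof -
    have "alg_norm A (f k) = (1 / real k) * alg_norm A (a [^] k)"
      using a by (simp add: f_def norm_smult norm_divide)
    also have "\<dots> \<le> 1 * alg_norm A a ^ k"
      using that norm_pow_Suc[OF a, of "k - 1"] norm_nonneg[of "a [^] k"] a
      by (intro mult_mono) auto
    finally show ?thesis by simp
  qed
  moreover have "summable (\<lambda>k. alg_norm A a ^ k)"
    using nu na0 by (intro summable_geometric) (simp add: a_def)
  ultimately obtain s where "limitin (alg_topology A) S s sequentially"
    unfolding S_def using absolutely_convergent_imp_convergent[of f] f by blast
  then have s: "s \<in> carrier A" and lim: "(\<lambda>n. alg_norm A (S n \<ominus> s)) \<longlonglongrightarrow> 0"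
    using S by (auto simp: limitin_iff_norm)
  have "alg_norm A (\<ominus> S n \<ominus> \<ominus> s) = alg_norm A (S n \<ominus> s)" for n
  proof -
    have "\<ominus> S n \<ominus> \<ominus> s = \<ominus> (S n \<ominus> s)"
      using S[of n] s by (simp add: alg_simps)
    then show ?thesis using S[of n] s by (simp add: norm_uminus alg_closed)
  qed
  then have lim': "(\<lambda>n. alg_norm A (\<ominus> S n \<ominus> \<ominus> s)) \<longlonglongrightarrow> 0"
    using lim by simp
  then have L: "limitin (alg_topology A) (\<lambda>n. \<ominus> S n) (\<ominus> s) sequentially"
    using S s by (subst limitin_iff_norm) (auto simp: alg_closed)
  have "alg_log A u = (THE l. limitin (alg_topology A) (\<lambda>n. \<ominus> S n) l sequentially)"
    by (simp add: alg_log_def S_def f_def a_def)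
  also have "\<dots> = \<ominus> s"
    using L by (rule the_equality) (rule metric.limitin_metric_unique[OF _ L], simp_all)
  finally have log: "alg_log A u = \<ominus> s" .
  have "(\<lambda>n. \<tau> (\<ominus> S n)) \<longlonglongrightarrow> \<tau> (\<ominus> s)"
    using lim' S s by (intro trace_tendsto) (auto simp: alg_closed)
  moreover have "\<tau> (\<ominus> S n) = (\<Sum>k<n. - (\<tau> (a [^] Suc k) / of_nat (Suc k)))" for n
  proof -
    have "\<tau> (\<ominus> S n) = - (\<Sum>k<n. \<tau> (f (Suc k)))"
      using S[of n] trace_finsum_Icc[of f n, OF f] by (simp add: trace_uminus S_def)
    also have "\<dots> = (\<Sum>k<n. - (\<tau> (a [^] Suc k) / of_nat (Suc k)))"
      using a by (simp add: f_def trace_smult sum_negf del: of_nat_Suc nat_pow_Suc)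
    finally show ?thesis .
  qed
  ultimately show ?thesis
    by (simp add: sums_def log a_def)
qed

text \<open>Under the trace all summands of \<open>pow_deriv\<close> become equal by cyclicity. The
  spare factor \<open>a [^] j\<close> makes the induction work: the factor \<open>a\<close> which
  the recursion appends on the right is absorbed into it.\<close>

lemma trace_pow_deriv_mult:
  assumes a: "a \<in> carrier A" and h: "h \<in> carrier A"
  shows "\<tau> (pow_deriv a h (Suc k) \<otimes> a [^] j) = of_nat (Suc k) * \<tau> (a [^] (k + j) \<otimes> h)"
proof (induction k arbitrary: j)
  case 0
  show ?case using a h trace_commute[of h "a [^] j"] by (simp add: alg_simps nat_pow_simps)
next
  case (Suc k)
  have p: "a [^] j \<in> carrier A" "a [^] Suc k \<in> carrier A" "a [^] Suc j \<in> carrier A"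
      "pow_deriv a h (Suc k) \<in> carrier A"
    using a h pow_deriv_closed[of a h "Suc k"] by auto
  have "pow_deriv a h (Suc (Suc k)) \<otimes> a [^] j
      = pow_deriv a h (Suc k) \<otimes> (a \<otimes> a [^] j) \<oplus> a [^] Suc k \<otimes> (h \<otimes> a [^] j)"
    using a h p pow_deriv.simps(2)[of a h "Suc k"]
    by (simp add: alg_simps del: pow_deriv.simps nat_pow_Suc)
  also have "a \<otimes> a [^] j = a [^] Suc j"
    by (rule monoid.nat_pow_Suc2[OF monoid_A a, symmetric])
  finally have "\<tau> (pow_deriv a h (Suc (Suc k)) \<otimes> a [^] j)
      = \<tau> (pow_deriv a h (Suc k) \<otimes> a [^] Suc j) + \<tau> (a [^] Suc k \<otimes> (h \<otimes> a [^] j))"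
    using a h p by (simp add: trace_add alg_closed del: pow_deriv.simps nat_pow_Suc)
  also have "\<tau> (a [^] Suc k \<otimes> (h \<otimes> a [^] j)) = \<tau> ((a [^] Suc k \<otimes> h) \<otimes> a [^] j)"
    using a h p by (simp add: alg_simps del: nat_pow_Suc)
  also have "\<dots> = \<tau> (a [^] j \<otimes> (a [^] Suc k \<otimes> h))"
    using a h p by (intro trace_commute) (auto simp: alg_closed)
  also have "a [^] j \<otimes> (a [^] Suc k \<otimes> h) = (a [^] j \<otimes> a [^] Suc k) \<otimes> h"
    using a h p by (simp add: alg_simps del: nat_pow_Suc)
  also have "a [^] j \<otimes> a [^] Suc k = a [^] (Suc k + j)"
    using monoid.nat_pow_mult[OF monoid_A a, of j "Suc k"] by (simp add: add_ac)
  also have "\<tau> (pow_deriv a h (Suc k) \<otimes> a [^] Suc j) = of_nat (Suc k) * \<tau> (a [^] (Suc k + j) \<otimes> h)"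
    unfolding Suc by simp
  finally show ?case by (simp add: algebra_simps)
qed

lemma trace_pow_deriv:
  assumes "a \<in> carrier A" "h \<in> carrier A"
  shows "\<tau> (pow_deriv a h (Suc k)) = of_nat (Suc k) * \<tau> (a [^] k \<otimes> h)"
  using trace_pow_deriv_mult[OF assms, of k 0] pow_deriv_closed[of a h "Suc k"] assms
  by (simp add: alg_simps nat_pow_simps(2) del: pow_deriv.simps)

end

lemma inv_mult_Units:
  assumes "monoid M" "x \<in> Units M" "y \<in> Units M"
  shows "inv\<^bsub>M\<^esub> (x \<otimes>\<^bsub>M\<^esub> y) = inv\<^bsub>M\<^esub> y \<otimes>\<^bsub>M\<^esub> inv\<^bsub>M\<^esub> x"
  using group.inv_mult_group[OF monoid.units_group[OF assms(1)], of x y] assms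
  by (simp add: units_of_carrier units_of_mult monoid.units_of_inv monoid.Units_m_closed)

text \<open>Dividing the bound by the distance shows that the derivative vanishes
  everywhere.\<close>

lemma constant_if_quadratic_modulus:
  fixes G :: "real \<Rightarrow> 'b::real_normed_vector"
  assumes "convex S"
    and G: "\<And>s t. s \<in> S \<Longrightarrow> t \<in> S \<Longrightarrow> norm (G t - G s) \<le> K * (t - s)\<^sup>2"
    and "s \<in> S" "t \<in> S"
  shows "G s = G t"
proof (rule has_derivative_zero_unique[OF \<open>convex S\<close> _ assms(3,4)])
  fix x assume x: "x \<in> S"
  show "(G has_derivative (\<lambda>h. 0)) (at x within S)"
  proof (rule has_derivativeI_sandwich[of 1 _ S x])
    show "norm (G y - G x - 0) / norm (y - x) \<le> K * \<bar>y - x\<bar>" if "y \<in> S" "y \<noteq> x" for y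
      using G[OF x that(1)] that(2) by (simp add: divide_le_eq power2_eq_square mult.assoc)
    have "((\<lambda>y. K * \<bar>y - x\<bar>) \<longlongrightarrow> K * \<bar>x - x\<bar>) (at x within S)"
      by (intro tendsto_intros)
    then show "((\<lambda>y. K * \<bar>y - x\<bar>) \<longlongrightarrow> 0) (at x within S)" by simp
  qed auto
qed

section \<open>First-order expansion and multiplicativity of the trace logarithm\<close>

context unital_tracial_banach_algebra
begin

text \<open>This is, up to sign, the logarithm series differentiated term by term, so it supplies
  the linear part of the expansion below.\<close>

lemma trace_geometric_sums:
  assumes a: "a \<in> carrier A" and h: "h \<in> carrier A" and na: "alg_norm A a < 1"
  shows "(\<lambda>k. \<tau> (a [^] k \<otimes> h)) sums \<tau> (inv (\<one> \<ominus> a) \<otimes> h)"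
proof -
  have unit: "\<one> \<ominus> a \<in> Units A" by (rule neumann_unit[OF a na])
  define w where "w = inv (\<one> \<ominus> a)"
  have w: "w \<in> carrier A" using monoid.Units_inv_closed[OF monoid_A unit] by (simp add: w_def)
  have wl: "w \<otimes> (\<one> \<ominus> a) = \<one>" using monoid.Units_l_inv[OF monoid_A unit] by (simp add: w_def)
  \<comment> \<open>Inserting \<open>w \<otimes> (\<one> \<ominus> a) = \<one>\<close> in front of
    each term makes the sum telescope.\<close>
  have sum: "(\<Sum>k<n. \<tau> (a [^] k \<otimes> h)) = \<tau> (w \<otimes> h) - \<tau> (w \<otimes> (a [^] n \<otimes> h))" for n :: nat
  proof (induction n)
    case 0
    show ?case using h by (simp add: alg_simps nat_pow_simps)
  next
    case (Suc n)
    have p: "a [^] n \<otimes> h \<in> carrier A" using a h by (simp add: alg_closed)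
    have "a [^] n \<otimes> h = (w \<otimes> (\<one> \<ominus> a)) \<otimes> (a [^] n \<otimes> h)"
      using wl p by (simp add: alg_one_mult)
    also have "\<dots> = w \<otimes> (a [^] n \<otimes> h) \<ominus> w \<otimes> (a \<otimes> (a [^] n \<otimes> h))"
      using w a p one_closed by algebra
    also have "a \<otimes> (a [^] n \<otimes> h) = a [^] Suc n \<otimes> h"
      unfolding monoid.nat_pow_Suc2[OF monoid_A a] using a h by (simp add: alg_simps)
    finally have "\<tau> (a [^] n \<otimes> h) = \<tau> (w \<otimes> (a [^] n \<otimes> h)) - \<tau> (w \<otimes> (a [^] Suc n \<otimes> h))"
      using w a h p trace_minus[of "w \<otimes> (a [^] n \<otimes> h)" "w \<otimes> (a [^] Suc n \<otimes> h)"]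
      by (simp add: alg_closed del: nat_pow_Suc)
    then show ?case using Suc by simp
  qed
  have "(\<lambda>n. \<tau> (w \<otimes> (a [^] n \<otimes> h))) \<longlonglongrightarrow> 0"
  proof (rule Lim_null_comparison)
    show "\<forall>\<^sub>F n in sequentially. norm (\<tau> (w \<otimes> (a [^] n \<otimes> h)))
        \<le> functional_norm A \<tau> * (alg_norm A w * (alg_norm A a ^ n * alg_norm A h))"
    proof (intro always_eventually allI)
      fix n :: nat
      have "alg_norm A (w \<otimes> (a [^] n \<otimes> h)) \<le> alg_norm A w * alg_norm A (a [^] n \<otimes> h)"
        using a w h by (intro norm_submult) (auto simp: alg_closed)
      also have "\<dots> \<le> alg_norm A w * (alg_norm A a ^ n * alg_norm A h)"
        using a w h by (intro mult_left_mono norm_pow_mult norm_nonneg)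
      finally have "functional_norm A \<tau> * alg_norm A (w \<otimes> (a [^] n \<otimes> h))
          \<le> functional_norm A \<tau> * (alg_norm A w * (alg_norm A a ^ n * alg_norm A h))"
        by (intro mult_left_mono functional_norm_nonneg)
      then show "norm (\<tau> (w \<otimes> (a [^] n \<otimes> h))) \<le> \<dots>"
        using norm_trace_le[of "w \<otimes> (a [^] n \<otimes> h)"] a w h by (simp add: alg_closed)
    qed
    have "(\<lambda>n. alg_norm A a ^ n) \<longlonglongrightarrow> 0"
      using na norm_nonneg[OF a] by (intro LIMSEQ_power_zero) simp
    then show "(\<lambda>n. functional_norm A \<tau> * (alg_norm A w * (alg_norm A a ^ n * alg_norm A h))) \<longlonglongrightarrow> 0"
      by (intro tendsto_mult_right_zero tendsto_mult_left_zero)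
  qed
  then show ?thesis
    unfolding sums_def sum w_def[symmetric] using tendsto_diff[OF tendsto_const, of "\<lambda>n. \<tau> (w \<otimes> (a [^] n \<otimes> h))" 0 sequentially "\<tau> (w \<otimes> h)"]
    by simp
qed

text \<open>The expansion is made term by term: the k-th term of the error is the trace of the
  Taylor remainder of a power, divided by its exponent. It matters that \<open>C\<close> is
  independent of \<open>u\<close> and \<open>v\<close>, since it is applied along a whole
  segment.\<close>

lemma trace_log_taylor:
  obtains C where "0 \<le> C"
    and "\<And>u v. \<lbrakk>u \<in> carrier A; v \<in> carrier A; alg_norm A (\<one> \<ominus> u) \<le> 1/2; alg_norm A (\<one> \<ominus> v) \<le> 1/2\<rbrakk>
      \<Longrightarrow> cmod (\<tau> (alg_log A v) - \<tau> (alg_log A u) - \<tau> (inv u \<otimes> (v \<ominus> u))) \<le> C * (alg_norm A (v \<ominus> u))\<^sup>2"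
proof -
  \<comment> \<open>What is left of the factor \<open>4 * m\<^sup>2 * (1/2) ^ m\<close> of
    \<open>norm_pow_taylor_le\<close>, with \<open>m = Suc k\<close>, after the division by
    \<open>m\<close>.\<close>
  let ?g = "\<lambda>k. 4 * (real (Suc k) * (1/2) ^ Suc k)"
  have "summable (\<lambda>k. real (Suc k) * (1/2::real) ^ k)"
    using geometric_deriv_sums[of "1/2::real"] by (auto simp: sums_iff)
  from summable_mult[OF this, of 2] have sg: "summable ?g" by simp
  define C where "C = functional_norm A \<tau> * suminf ?g"
  have "0 \<le> suminf ?g" by (intro suminf_nonneg sg) simp
  then have C0: "0 \<le> C" by (simp add: C_def functional_norm_nonneg)
  have "cmod (\<tau> (alg_log A v) - \<tau> (alg_log A u) - \<tau> (inv u \<otimes> (v \<ominus> u))) \<le> C * (alg_norm A (v \<ominus> u))\<^sup>2"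
    if u: "u \<in> carrier A" and v: "v \<in> carrier A"
      and nu: "alg_norm A (\<one> \<ominus> u) \<le> 1/2" and nv: "alg_norm A (\<one> \<ominus> v) \<le> 1/2" for u v
  proof -
    define a b h where "a = \<one> \<ominus> u" and "b = \<one> \<ominus> v" and "h = b \<ominus> a"
    have c: "a \<in> carrier A" "b \<in> carrier A" "h \<in> carrier A"
      using u v by (auto simp: a_def b_def h_def alg_simps)
    have na: "alg_norm A a \<le> 1/2" and nb: "alg_norm A b \<le> 1/2"
      using nu nv by (auto simp: a_def b_def)
    have ua: "\<one> \<ominus> a = u" unfolding a_def using u one_closed by algebra
    have vu: "v \<ominus> u = \<ominus> h" unfolding a_def b_def h_def using u v one_closed by algebra
    have unit: "u \<in> Units A" using neumann_unit[of a] c na by (simp add: ua)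
    have w: "inv u \<in> carrier A" using monoid.Units_inv_closed[OF monoid_A unit] .
    have s1: "(\<lambda>k. - (\<tau> (a [^] Suc k) / of_nat (Suc k))) sums \<tau> (alg_log A u)"
      using trace_log_sums[OF u] nu by (simp add: a_def del: of_nat_Suc nat_pow_Suc)
    have s2: "(\<lambda>k. - (\<tau> (b [^] Suc k) / of_nat (Suc k))) sums \<tau> (alg_log A v)"
      using trace_log_sums[OF v] nv by (simp add: b_def del: of_nat_Suc nat_pow_Suc)
    have s3: "(\<lambda>k. \<tau> (a [^] k \<otimes> h)) sums \<tau> (inv u \<otimes> h)"
      using trace_geometric_sums[of a h] c na by (simp add: ua)
    \<comment> \<open>The linear term carries a plus sign because \<open>v \<ominus> u\<close>
      equals \<open>\<ominus> h\<close>.\<close>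
    let ?t = "\<lambda>k. - (\<tau> (b [^] Suc k) / of_nat (Suc k)) - - (\<tau> (a [^] Suc k) / of_nat (Suc k)) + \<tau> (a [^] k \<otimes> h)"
    have s: "?t sums (\<tau> (alg_log A v) - \<tau> (alg_log A u) + \<tau> (inv u \<otimes> h))"
      by (intro sums_add sums_diff s1 s2 s3)
    let ?B = "functional_norm A \<tau> * (alg_norm A h)\<^sup>2"
    have t: "cmod (?t k) \<le> ?B * ?g k" for k
    proof -
      define r where "r = b [^] Suc k \<ominus> a [^] Suc k \<ominus> pow_deriv a h (Suc k)"
      have pk: "b [^] Suc k \<in> carrier A" "a [^] Suc k \<in> carrier A" "pow_deriv a h (Suc k) \<in> carrier A"
        using c by (auto simp: pow_deriv_closed simp del: pow_deriv.simps nat_pow_Suc)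
      have r: "r \<in> carrier A"
        unfolding r_def using pk by (simp add: alg_closed del: pow_deriv.simps nat_pow_Suc)
      have "\<tau> r = \<tau> (b [^] Suc k) - \<tau> (a [^] Suc k) - of_nat (Suc k) * \<tau> (a [^] k \<otimes> h)"
        unfolding r_def using pk c
        by (simp add: trace_minus trace_pow_deriv alg_closed del: pow_deriv.simps nat_pow_Suc of_nat_Suc)
      then have "?t k = - (\<tau> r / of_nat (Suc k))"
        by (simp add: diff_divide_distrib del: nat_pow_Suc of_nat_Suc)
      then have "cmod (?t k) = cmod (\<tau> r) / real (Suc k)"
        by (simp add: norm_divide del: nat_pow_Suc of_nat_Suc)
      also have "\<dots> \<le> (functional_norm A \<tau> * alg_norm A r) / real (Suc k)"
        by (intro divide_right_mono norm_trace_le r) simp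
      also have "\<dots> \<le> (functional_norm A \<tau> * (4 * (real (Suc k))\<^sup>2 * (1/2) ^ Suc k * (alg_norm A h)\<^sup>2)) / real (Suc k)"
        using norm_pow_taylor_le[OF c(1,2) na nb, of "Suc k"]
        unfolding r_def h_def by (intro divide_right_mono mult_left_mono functional_norm_nonneg) auto
      also have "\<dots> = ?B * ?g k"
        by (simp add: power2_eq_square del: of_nat_Suc)
      finally show ?thesis .
    qed
    have sB: "summable (\<lambda>k. ?B * ?g k)" by (intro summable_mult sg)
    have "cmod (\<tau> (alg_log A v) - \<tau> (alg_log A u) + \<tau> (inv u \<otimes> h)) = cmod (suminf ?t)"
      using sums_unique[OF s] by simp
    also have "\<dots> \<le> suminf (\<lambda>k. ?B * ?g k)"
      by (rule norm_suminf_le) (use t sB in auto)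
    also have "\<dots> = C * (alg_norm A h)\<^sup>2"
      unfolding C_def using suminf_mult[OF sg, of ?B] by (simp add: mult_ac)
    finally show ?thesis
      unfolding vu using c w by (simp add: norm_uminus trace_uminus alg_simps)
  qed
  then show ?thesis using that C0 by blast
qed

text \<open>The comparison along a segment is carried out with finite increments: the linear parts
  of the two expansions cancel, so their difference is constant. The radius 1/5 keeps the products
  \<open>q t\<close> within distance 1/2 of the unit.\<close>

lemma trace_log_mult:
  assumes u: "u \<in> carrier A" and v: "v \<in> carrier A"
    and nu: "alg_norm A (\<one> \<ominus> u) \<le> 1/5" and nv: "alg_norm A (\<one> \<ominus> v) \<le> 1/5"
  shows "\<tau> (alg_log A (u \<otimes> v)) = \<tau> (alg_log A u) + \<tau> (alg_log A v)"
proof -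
  define x where "x = u \<ominus> \<one>"
  have x: "x \<in> carrier A" using u by (simp add: x_def alg_simps)
  have nx: "alg_norm A x \<le> 1/5" using nu u norm_minus_commute[of u \<one>] by (simp add: x_def alg_simps)
  define p where "p t = \<one> \<oplus> complex_of_real t \<odot> x" for t
  have p: "p t \<in> carrier A" for t using x by (simp add: p_def alg_closed)
  define q where "q t = p t \<otimes> v" for t
  have q: "q t \<in> carrier A" for t using p v by (simp add: q_def alg_simps)
  have p1: "p 1 = u" using u x smult_one[OF x] by (simp add: p_def x_def alg_simps)
  have p0: "p 0 = \<one>" using x smult_l_null[OF x] by (simp add: p_def alg_simps)
  have np: "alg_norm A (\<one> \<ominus> p t) \<le> 1/5" if t: "t \<in> {0..1}" for t
  proof -
    have "\<one> \<ominus> p t = \<ominus> (complex_of_real t \<odot> x)"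
      using x by (simp add: p_def alg_simps)
    then have "alg_norm A (\<one> \<ominus> p t) = \<bar>t\<bar> * alg_norm A x"
      using x by (simp add: norm_uminus norm_smult)
    also have "\<dots> \<le> 1 * (1/5)" using nx t norm_nonneg[OF x] by (intro mult_mono) auto
    finally show ?thesis by simp
  qed
  have nq: "alg_norm A (\<one> \<ominus> q t) \<le> 1/2" if t: "t \<in> {0..1}" for t
  proof -
    let ?a = "\<one> \<ominus> p t" and ?b = "\<one> \<ominus> v"
    have ab: "?a \<in> carrier A" "?b \<in> carrier A" using p v by (auto simp: alg_simps)
    \<comment> \<open>Expanding \<open>(\<one> \<ominus> ?a) \<otimes> (\<one> \<ominus> ?b)\<close>
      yields the bound 1/5 + 1/5 + 1/25, which is below 1/2.\<close>
    have "\<one> \<ominus> q t = (?a \<oplus> ?b) \<ominus> ?a \<otimes> ?b"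
      unfolding q_def using p[of t] v one_closed monoid.r_one[OF monoid_A p[of t]] by algebra
    then have "alg_norm A (\<one> \<ominus> q t) \<le> alg_norm A (?a \<oplus> ?b) + alg_norm A (?a \<otimes> ?b)"
      using norm_triangle[of "?a \<oplus> ?b" "\<ominus> (?a \<otimes> ?b)"] norm_uminus[of "?a \<otimes> ?b"] ab
      by (simp add: alg_simps)
    also have "\<dots> \<le> (alg_norm A ?a + alg_norm A ?b) + alg_norm A ?a * alg_norm A ?b"
      using ab by (intro add_mono norm_triangle norm_submult)
    also have "\<dots> \<le> (1/5 + 1/5) + (1/5) * (1/5)"
      using np[OF t] nv ab by (intro add_mono mult_mono) (auto intro: norm_nonneg)
    finally show ?thesis by simp
  qed
  have vU: "v \<in> Units A"
    using neumann_unit[of "\<one> \<ominus> v"] nv v by (simp add: alg_simps)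
  have pU: "p t \<in> Units A" if "t \<in> {0..1}" for t
  proof -
    have "\<one> \<ominus> (\<one> \<ominus> p t) = p t" using p[of t] one_closed by algebra
    then show ?thesis using neumann_unit[of "\<one> \<ominus> p t"] np[OF that] p[of t] by (simp add: alg_closed alg_closed)
  qed
  obtain C where C0: "0 \<le> C" and C:
    "\<And>u v. \<lbrakk>u \<in> carrier A; v \<in> carrier A; alg_norm A (\<one> \<ominus> u) \<le> 1/2; alg_norm A (\<one> \<ominus> v) \<le> 1/2\<rbrakk>
      \<Longrightarrow> cmod (\<tau> (alg_log A v) - \<tau> (alg_log A u) - \<tau> (inv u \<otimes> (v \<ominus> u))) \<le> C * (alg_norm A (v \<ominus> u))\<^sup>2"
    using trace_log_taylor by blast
  \<comment> \<open>At 1 this is the trace logarithm of \<open>u \<otimes> v\<close> minus that of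
    \<open>u\<close>; at 0 it is that of \<open>v\<close> minus that of the unit, which
    vanishes.\<close>
  define G where "G t = \<tau> (alg_log A (q t)) - \<tau> (alg_log A (p t))" for t
  define K where "K = C * (alg_norm A (x \<otimes> v))\<^sup>2 + C * (alg_norm A x)\<^sup>2"
  have "cmod (G t - G s) \<le> K * (t - s)\<^sup>2" if s: "s \<in> {0..1}" and t: "t \<in> {0..1}" for s t
  proof -
    define c where "c = complex_of_real (t - s)"
    have cx: "c \<odot> x \<in> carrier A" using x by simp
    have "complex_of_real t \<odot> x = c \<odot> x \<oplus> complex_of_real s \<odot> x"
      using smult_l_distr[of c "complex_of_real s" x] x by (simp add: c_def)
    then have pt: "p t = p s \<oplus> c \<odot> x"
      unfolding p_def using x by (simp add: alg_simps)
    have dp: "p t \<ominus> p s = c \<odot> x"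
      unfolding pt using p[of s] cx by algebra
    have dq: "q t \<ominus> q s = (c \<odot> x) \<otimes> v"
      unfolding q_def pt using p[of s] cx v by algebra
    have ndp: "alg_norm A (p t \<ominus> p s) = \<bar>t - s\<bar> * alg_norm A x"
      using x by (simp add: dp norm_smult c_def del: of_real_diff)
    have ndq: "alg_norm A (q t \<ominus> q s) = \<bar>t - s\<bar> * alg_norm A (x \<otimes> v)"
      using x v by (simp add: dq smult_mult_left norm_smult c_def alg_closed del: of_real_diff)
    define w where "w = inv (p s)"
    have w: "w \<in> carrier A" using monoid.Units_inv_closed[OF monoid_A pU[OF s]] by (simp add: w_def)
    have iv: "inv v \<in> carrier A" using monoid.Units_inv_closed[OF monoid_A vU] .
    have iq: "inv (q s) = inv v \<otimes> w"
      unfolding q_def w_def by (rule inv_mult_Units[OF monoid_A pU[OF s] vU])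
    \<comment> \<open>The linear part for \<open>q\<close> is a conjugate, by \<open>v\<close>, of
      the linear part for \<open>p\<close>, so the trace does not distinguish them.\<close>
    have "\<tau> (inv (q s) \<otimes> (q t \<ominus> q s)) = \<tau> (inv v \<otimes> (w \<otimes> (c \<odot> x) \<otimes> v))"
      unfolding iq dq using iv w cx v by (simp add: alg_simps)
    also have "\<dots> = \<tau> ((w \<otimes> (c \<odot> x) \<otimes> v) \<otimes> inv v)"
      using iv w cx v by (intro trace_commute) (auto simp: alg_closed)
    also have "(w \<otimes> (c \<odot> x) \<otimes> v) \<otimes> inv v = w \<otimes> (c \<odot> x) \<otimes> (v \<otimes> inv v)"
      using iv w cx v by (simp add: alg_simps)
    also have "\<dots> = w \<otimes> (p t \<ominus> p s)"
      using monoid.Units_r_inv[OF monoid_A vU] w cx unfolding dp by (simp add: alg_simps)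
    finally have eq: "\<tau> (inv (q s) \<otimes> (q t \<ominus> q s)) = \<tau> (inv (p s) \<otimes> (p t \<ominus> p s))"
      by (simp add: w_def)
    define Dq where "Dq = \<tau> (alg_log A (q t)) - \<tau> (alg_log A (q s)) - \<tau> (inv (q s) \<otimes> (q t \<ominus> q s))"
    define Dp where "Dp = \<tau> (alg_log A (p t)) - \<tau> (alg_log A (p s)) - \<tau> (inv (p s) \<otimes> (p t \<ominus> p s))"
    have "G t - G s = Dq - Dp"
      by (simp add: G_def Dq_def Dp_def eq)
    then have "cmod (G t - G s) \<le> cmod Dq + cmod Dp"
      by (simp add: norm_triangle_ineq4)
    also have "\<dots> \<le> C * (alg_norm A (q t \<ominus> q s))\<^sup>2 + C * (alg_norm A (p t \<ominus> p s))\<^sup>2"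
      unfolding Dq_def Dp_def using np[OF s] np[OF t] nq[OF s] nq[OF t] p q
      by (intro add_mono C) auto
    also have "\<dots> = K * (t - s)\<^sup>2"
      by (simp add: ndp ndq K_def power_mult_distrib algebra_simps)
    finally show ?thesis .
  qed
  then have "G 1 = G 0" by (intro constant_if_quadratic_modulus[of "{0..1}" G K]) auto
  moreover have "\<tau> (alg_log A \<one>) = 0"
  proof -
    have "\<one> \<ominus> \<one> = \<zero>" by (simp add: alg_simps)
    from trace_log_sums[of \<one>, unfolded this]
    have "(\<lambda>k. 0) sums \<tau> (alg_log A \<one>)"
      by (simp add: nat_pow_simps alg_simps)
    then show ?thesis using sums_unique2 sums_zero by blast
  qed
  moreover have "q 0 = v" using v by (simp add: q_def p0 alg_simps)
  ultimately show ?thesis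
    by (simp add: G_def q_def p1 p0 diff_eq_eq add.commute)
qed

text \<open>Geometric comparison of the series with ratio 1/2, discarding the denominators
  \<open>Suc k\<close>; the factor 2 is the sum of the geometric series.\<close>

lemma norm_trace_log_le:
  assumes u: "u \<in> carrier A" and nu: "alg_norm A (\<one> \<ominus> u) \<le> 1/2"
  shows "cmod (\<tau> (alg_log A u)) \<le> 2 * functional_norm A \<tau> * alg_norm A (\<one> \<ominus> u)"
proof -
  define a where "a = \<one> \<ominus> u"
  have a: "a \<in> carrier A" using u by (simp add: a_def alg_simps)
  have na: "alg_norm A a \<le> 1/2" using nu by (simp add: a_def)
  let ?M = "functional_norm A \<tau> * alg_norm A a"
  have s: "(\<lambda>k. - (\<tau> (a [^] Suc k) / of_nat (Suc k))) sums \<tau> (alg_log A u)"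
    using trace_log_sums[OF u] nu by (simp add: a_def del: of_nat_Suc nat_pow_Suc)
  have g: "(\<lambda>k. ?M * (1/2) ^ k) sums (?M * 2)"
    using geometric_sums[of "1/2::real"] by (intro sums_mult) simp
  have "cmod (- (\<tau> (a [^] Suc k) / of_nat (Suc k))) \<le> ?M * (1/2) ^ k" for k
  proof -
    have "alg_norm A (a [^] Suc k) \<le> alg_norm A a * alg_norm A a ^ k"
      using norm_pow_Suc[OF a, of k] by simp
    also have "\<dots> \<le> alg_norm A a * (1/2) ^ k"
      using na norm_nonneg[OF a] by (intro mult_left_mono power_mono)
    finally have "functional_norm A \<tau> * alg_norm A (a [^] Suc k) \<le> ?M * (1/2) ^ k"
      using functional_norm_nonneg by (simp add: mult.assoc mult_left_mono del: nat_pow_Suc)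
    then have "cmod (\<tau> (a [^] Suc k)) \<le> ?M * (1/2) ^ k"
      using norm_trace_le[of "a [^] Suc k"] pow_closed[OF a, of "Suc k"] by linarith
    moreover have "cmod (- (\<tau> (a [^] Suc k) / of_nat (Suc k))) \<le> cmod (\<tau> (a [^] Suc k))"
      by (simp add: norm_divide divide_le_eq mult_le_cancel_left1 del: of_nat_Suc nat_pow_Suc)
    ultimately show ?thesis by linarith
  qed
  then have "cmod (suminf (\<lambda>k. - (\<tau> (a [^] Suc k) / of_nat (Suc k)))) \<le> suminf (\<lambda>k. ?M * (1/2) ^ k)"
    using g by (intro norm_suminf_le) (auto simp: sums_iff)
  then show ?thesis
    using sums_unique[OF s] sums_unique[OF g] by (simp add: a_def mult_ac)
qed

text \<open>The two series agree term by term, since powers commute with conjugation and the trace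
  is cyclic. Conjugation may enlarge norms, hence separate assumptions for the convergence of the
  two series.\<close>

lemma trace_log_conj:
  assumes g: "g \<in> Units A" and u: "u \<in> carrier A"
    and nu: "alg_norm A (\<one> \<ominus> u) < 1" and ng: "alg_norm A (\<one> \<ominus> g \<otimes> u \<otimes> inv g) < 1"
  shows "\<tau> (alg_log A (g \<otimes> u \<otimes> inv g)) = \<tau> (alg_log A u)"
proof -
  have gc: "g \<in> carrier A" "inv g \<in> carrier A"
    using g monoid.Units_inv_closed[OF monoid_A g] by (auto simp: monoid.Units_closed[OF monoid_A])
  have inv: "inv g \<otimes> g = \<one>" "g \<otimes> inv g = \<one>"
    using monoid.Units_l_inv[OF monoid_A g] monoid.Units_r_inv[OF monoid_A g] by auto
  define a where "a = \<one> \<ominus> u"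
  have a: "a \<in> carrier A" using u by (simp add: a_def alg_simps)
  have gug: "\<one> \<ominus> g \<otimes> u \<otimes> inv g = g \<otimes> a \<otimes> inv g"
    using gc u inv by (simp add: a_def alg_simps)
  have pow: "(g \<otimes> a \<otimes> inv g) [^] k = g \<otimes> a [^] k \<otimes> inv g" for k :: nat
  proof (induction k)
    case 0
    show ?case using gc inv by (simp add: nat_pow_simps alg_simps)
  next
    case (Suc k)
    have p: "a [^] k \<in> carrier A" using a by simp
    have "(g \<otimes> a \<otimes> inv g) [^] Suc k = g \<otimes> a [^] k \<otimes> (inv g \<otimes> g) \<otimes> a \<otimes> inv g"
      using Suc gc a p by (simp add: nat_pow_simps alg_simps)
    then show ?case using inv gc a p by (simp add: nat_pow_simps alg_simps)
  qed
  have trpow: "\<tau> ((g \<otimes> a \<otimes> inv g) [^] k) = \<tau> (a [^] k)" for k :: nat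
  proof -
    have p: "a [^] k \<in> carrier A" using a by simp
    have "\<tau> ((g \<otimes> a \<otimes> inv g) [^] k) = \<tau> (inv g \<otimes> (g \<otimes> a [^] k))"
      unfolding pow using gc p by (intro trace_commute) (auto simp: alg_closed)
    also have "inv g \<otimes> (g \<otimes> a [^] k) = (inv g \<otimes> g) \<otimes> a [^] k"
      using gc p by (simp add: alg_simps)
    finally show ?thesis using inv p by (simp add: alg_simps)
  qed
  have "(\<lambda>k. - (\<tau> (a [^] Suc k) / of_nat (Suc k))) sums \<tau> (alg_log A (g \<otimes> u \<otimes> inv g))"
    using trace_log_sums[of "g \<otimes> u \<otimes> inv g"] ng gc u unfolding gug trpow
    by (simp add: alg_closed del: nat_pow_Suc of_nat_Suc)
  moreover have "(\<lambda>k. - (\<tau> (a [^] Suc k) / of_nat (Suc k))) sums \<tau> (alg_log A u)"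
    unfolding a_def by (rule trace_log_sums[OF u nu])
  ultimately show ?thesis by (rule sums_unique2)
qed

end

section \<open>Null sequences and second cohomology\<close>

lemma comm_group_c0: "comm_group c0"
proof (rule comm_groupI)
  fix x assume "x \<in> carrier c0"
  then show "\<exists>y\<in>carrier c0. y \<otimes>\<^bsub>c0\<^esub> x = \<one>\<^bsub>c0\<^esub>"
    using tendsto_minus[of x 0] by (intro bexI[of _ "\<lambda>n. - x n"]) (auto simp: c0_def)
qed (auto simp: c0_def intro: tendsto_add_zero)

lemma eventually_zero_imp_c00: "eventually (\<lambda>n. x n = 0) sequentially \<Longrightarrow> x \<in> c00"
proof -
  assume "eventually (\<lambda>n. x n = 0) sequentially"
  then obtain N where "\<And>n. n \<ge> N \<Longrightarrow> x n = 0"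
    by (auto simp: eventually_sequentially)
  then have "{n. x n \<noteq> 0} \<subseteq> {..<N}"
    by (auto simp: not_le[symmetric])
  then show "x \<in> c00"
    unfolding c00_def using finite_subset by blast
qed

lemma c00_imp_eventually_zero: "x \<in> c00 \<Longrightarrow> eventually (\<lambda>n. x n = 0) sequentially"
proof -
  assume "x \<in> c00"
  then have "eventually (\<lambda>n. n \<notin> {n. x n \<noteq> 0}) cofinite"
    by (simp add: c00_def eventually_cofinite)
  then show "eventually (\<lambda>n. x n = 0) sequentially"
    by (simp add: cofinite_eq_sequentially)
qed

lemma subgroup_c00: "subgroup c00 c0"
proof (rule group.subgroupI[OF comm_group.axioms(2)[OF comm_group_c0]])
  show "c00 \<subseteq> carrier c0"
    by (auto simp: c0_def dest!: c00_imp_eventually_zero intro: tendsto_eventually)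
  show "c00 \<noteq> {}"
    by (auto simp: c00_def intro: exI[of _ "\<lambda>n. 0"])
next
  fix x y assume xy: "x \<in> c00" "y \<in> c00"
  from xy[THEN c00_imp_eventually_zero] have "eventually (\<lambda>n. x n + y n = 0) sequentially"
    by eventually_elim simp
  then show "x \<otimes>\<^bsub>c0\<^esub> y \<in> c00"
    by (simp add: c0_def eventually_zero_imp_c00)
next
  fix x assume x: "x \<in> c00"
  then have x0: "x \<longlonglongrightarrow> 0"
    by (auto dest!: c00_imp_eventually_zero intro: tendsto_eventually)
  have "inv\<^bsub>c0\<^esub> x = (\<lambda>n. - x n)"
    using x0 tendsto_minus[OF x0]
    by (intro group.inv_equality[OF comm_group.axioms(2)[OF comm_group_c0]]) (auto simp: c0_def)
  then show "inv\<^bsub>c0\<^esub> x \<in> c00"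
    using x by (simp add: c00_def)
qed

lemma normal_c00: "c00 \<lhd> c0"
  by (rule comm_group.subgroup_imp_normal[OF comm_group_c0 subgroup_c00])

lemma comm_group_QC: "comm_group QC"
  unfolding QC_def by (rule comm_group.abelian_FactGroup[OF comm_group_c0 subgroup_c00])

lemma QC_class_closed: "x \<longlonglongrightarrow> 0 \<Longrightarrow> QC_class x \<in> carrier QC"
  by (auto simp: QC_class_def QC_def FactGroup_def RCOSETS_def c0_def)

lemma QC_class_mult:
  assumes "x \<longlonglongrightarrow> 0" "y \<longlonglongrightarrow> 0"
  shows "QC_class x \<otimes>\<^bsub>QC\<^esub> QC_class y = QC_class (\<lambda>n. x n + y n)"
  using normal.rcos_sum[OF normal_c00, of x y] assms
  by (simp add: QC_class_def QC_def FactGroup_def c0_def)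

lemma QC_class_cong:
  assumes "eventually (\<lambda>n. x n = y n) sequentially" "x \<longlonglongrightarrow> 0" "y \<longlonglongrightarrow> 0"
  shows "QC_class x = QC_class y"
proof -
  have "eventually (\<lambda>n. x n - y n = 0) sequentially"
    using assms(1) by eventually_elim simp
  then have "(\<lambda>n. x n - y n) \<in> c00" by (rule eventually_zero_imp_c00)
  then have "x \<in> c00 #>\<^bsub>c0\<^esub> y"
    by (auto simp: r_coset_def c0_def intro!: bexI[of _ "\<lambda>n. x n - y n"])
  then show ?thesis
    unfolding QC_class_def
    using group.repr_independence[OF comm_group.axioms(2)[OF comm_group_c0] _ _ subgroup_c00] assms(3)
    by (metis (mono_tags, lifting) c0_def mem_Collect_eq partial_object.select_convs(1))
qed

lemma Z2_mult_coboundary: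
  assumes G: "group G" and Q: "comm_group Q"
    and \<gamma>: "\<gamma> \<in> carrier G \<rightarrow> carrier Q" and \<delta>: "\<delta> \<in> carrier G \<rightarrow> carrier Q"
  shows "coboundary G Q \<delta> \<otimes>\<^bsub>Z2 G Q\<^esub> coboundary G Q \<gamma> = coboundary G Q (\<lambda>a. \<delta> a \<otimes>\<^bsub>Q\<^esub> \<gamma> a)"
proof -
  interpret G: group G by fact
  interpret Q: comm_group Q by fact
  have "\<delta> a \<otimes>\<^bsub>Q\<^esub> inv\<^bsub>Q\<^esub> \<delta> (a \<otimes>\<^bsub>G\<^esub> b) \<otimes>\<^bsub>Q\<^esub> \<delta> b \<otimes>\<^bsub>Q\<^esub> (\<gamma> a \<otimes>\<^bsub>Q\<^esub> inv\<^bsub>Q\<^esub> \<gamma> (a \<otimes>\<^bsub>G\<^esub> b) \<otimes>\<^bsub>Q\<^esub> \<gamma> b)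
      = \<delta> a \<otimes>\<^bsub>Q\<^esub> \<gamma> a \<otimes>\<^bsub>Q\<^esub> inv\<^bsub>Q\<^esub> (\<delta> (a \<otimes>\<^bsub>G\<^esub> b) \<otimes>\<^bsub>Q\<^esub> \<gamma> (a \<otimes>\<^bsub>G\<^esub> b)) \<otimes>\<^bsub>Q\<^esub> (\<delta> b \<otimes>\<^bsub>Q\<^esub> \<gamma> b)"
    if "a \<in> carrier G" "b \<in> carrier G" for a b
  proof -
    have "a \<otimes>\<^bsub>G\<^esub> b \<in> carrier G" using that by simp
    then have "\<gamma> a \<in> carrier Q" "\<gamma> b \<in> carrier Q" "\<gamma> (a \<otimes>\<^bsub>G\<^esub> b) \<in> carrier Q"
      "\<delta> a \<in> carrier Q" "\<delta> b \<in> carrier Q" "\<delta> (a \<otimes>\<^bsub>G\<^esub> b) \<in> carrier Q"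
      using that \<gamma> \<delta> by auto
    then show ?thesis by (simp add: Q.inv_mult Q.m_ac)
  qed
  then show ?thesis
    by (auto simp: Z2_def coboundary_def intro!: restrict_ext)
qed

text \<open>The unit of the factor group is the set \<open>B2 G Q\<close> itself, so the claim is
  that translation by a coboundary maps this set onto itself.\<close>

lemma H2_class_coboundary:
  assumes G: "group G" and Q: "comm_group Q" and \<gamma>: "\<gamma> \<in> carrier G \<rightarrow> carrier Q"
  shows "H2_class G Q (coboundary G Q \<gamma>) = \<one>\<^bsub>H2 G Q\<^esub>"
proof -
  interpret Q: comm_group Q by fact
  have "B2 G Q #>\<^bsub>Z2 G Q\<^esub> coboundary G Q \<gamma> = B2 G Q"
  proof (intro Set.set_eqI iffI)
    fix \<omega> assume "\<omega> \<in> B2 G Q #>\<^bsub>Z2 G Q\<^esub> coboundary G Q \<gamma>"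
    then obtain \<delta> where \<delta>: "\<delta> \<in> carrier G \<rightarrow> carrier Q"
      and \<omega>: "\<omega> = coboundary G Q \<delta> \<otimes>\<^bsub>Z2 G Q\<^esub> coboundary G Q \<gamma>"
      by (auto simp: r_coset_def B2_def)
    have "(\<lambda>a. \<delta> a \<otimes>\<^bsub>Q\<^esub> \<gamma> a) \<in> carrier G \<rightarrow> carrier Q"
      using \<gamma> \<delta> by auto
    then show "\<omega> \<in> B2 G Q"
      unfolding \<omega> Z2_mult_coboundary[OF G Q \<gamma> \<delta>] B2_def by (rule imageI)
  next
    fix \<omega> assume "\<omega> \<in> B2 G Q"
    then obtain \<delta> where \<delta>: "\<delta> \<in> carrier G \<rightarrow> carrier Q" and \<omega>: "\<omega> = coboundary G Q \<delta>"
      by (auto simp: B2_def)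
    \<comment> \<open>Dividing \<open>\<delta>\<close> by \<open>\<gamma>\<close> gives the preimage
      of \<open>\<omega>\<close> under the translation.\<close>
    define \<epsilon> where "\<epsilon> a = \<delta> a \<otimes>\<^bsub>Q\<^esub> inv\<^bsub>Q\<^esub> \<gamma> a" for a
    have \<epsilon>: "\<epsilon> \<in> carrier G \<rightarrow> carrier Q"
      using \<gamma> \<delta> by (simp add: \<epsilon>_def Pi_iff)
    have "\<epsilon> a \<otimes>\<^bsub>Q\<^esub> \<gamma> a = \<delta> a" if "a \<in> carrier G" for a
      using that \<gamma> \<delta> by (simp add: \<epsilon>_def Q.m_assoc Pi_iff)
    then have "coboundary G Q (\<lambda>a. \<epsilon> a \<otimes>\<^bsub>Q\<^esub> \<gamma> a) = coboundary G Q \<delta>"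
      using G by (auto simp: coboundary_def group.is_monoid monoid.m_closed intro!: restrict_ext)
    then have "\<omega> = coboundary G Q \<epsilon> \<otimes>\<^bsub>Z2 G Q\<^esub> coboundary G Q \<gamma>"
      unfolding \<omega> Z2_mult_coboundary[OF G Q \<gamma> \<epsilon>] by simp
    then show "\<omega> \<in> B2 G Q #>\<^bsub>Z2 G Q\<^esub> coboundary G Q \<gamma>"
      using \<epsilon> by (auto simp: r_coset_def B2_def)
  qed
  then show ?thesis
    by (simp add: H2_class_def H2_def FactGroup_def)
qed

section \<open>Sequences of units converging to the unit\<close>

context monoid
begin

text \<open>Once \<open>m_assoc\<close> has nested products to the right, these rules remove
  adjacent inverse pairs inside them.\<close>

lemma Units_cancel [simp]:
  assumes "x \<in> Units G" "y \<in> carrier G"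
  shows "inv x \<otimes> (x \<otimes> y) = y" "x \<otimes> (inv x \<otimes> y) = y"
  proof -
  have c: "x \<in> carrier G" "inv x \<in> carrier G" using assms by auto
  show "inv x \<otimes> (x \<otimes> y) = y"
    unfolding m_assoc[OF c(2,1) assms(2), symmetric] using assms by simp
  show "x \<otimes> (inv x \<otimes> y) = y"
    unfolding m_assoc[OF c assms(2), symmetric] using assms by simp
qed

text \<open>Both sides reduce to \<open>a \<otimes> b \<otimes> c \<otimes> inv r\<close>. In the
  application \<open>p\<close>, \<open>q\<close> and \<open>r\<close> are the values of \<rho> at
  ab, bc and abc.\<close>

lemma defect_cocycle_identity:
  assumes "a \<in> Units G" "b \<in> Units G" "c \<in> Units G" "p \<in> Units G" "q \<in> Units G" "r \<in> Units G"
  shows "(a \<otimes> b \<otimes> inv p) \<otimes> (p \<otimes> c \<otimes> inv r) = (a \<otimes> (b \<otimes> c \<otimes> inv q) \<otimes> inv a) \<otimes> (a \<otimes> q \<otimes> inv r)"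
  using assms by (simp add: m_assoc Units_closed)

text \<open>Both sides reduce to \<open>a \<otimes> b \<otimes> inv y \<otimes> inv x\<close>. In
  the application \<open>c\<close> is the value of \<rho> at the product, and \<open>x\<close>,
  \<open>y\<close> are values of \<pi>.\<close>

lemma defect_coboundary_identity:
  assumes "a \<in> Units G" "b \<in> Units G" "c \<in> Units G" "x \<in> Units G" "y \<in> Units G"
  shows "(a \<otimes> b \<otimes> inv c) \<otimes> (c \<otimes> inv (x \<otimes> y)) = (a \<otimes> inv x) \<otimes> (x \<otimes> (b \<otimes> inv y) \<otimes> inv x)"
  using assms inv_mult_Units[OF monoid_axioms, of x y] by (simp add: m_assoc Units_closed)

end

section \<open>Norm estimates for inverses, conjugates and quotients\<close>

context unital_banach_algebra
begin

text \<open>For e = 1 - x and f = 1 - y, where y is the inverse of x, one has ef = e + f. Thus f =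
  ef - e, and the norm of ef is at most half that of f.\<close>

lemma norm_one_minus_inv_le:
  assumes x: "x \<in> Units A" and nx: "alg_norm A (\<one> \<ominus> x) \<le> 1/2"
  shows "alg_norm A (\<one> \<ominus> inv x) \<le> 2 * alg_norm A (\<one> \<ominus> x)"
proof -
  define y where "y = inv x"
  have c: "x \<in> carrier A" "y \<in> carrier A"
    using x monoid.Units_closed[OF monoid_A x] monoid.Units_inv_closed[OF monoid_A x]
    by (auto simp: y_def)
  define e f where "e = \<one> \<ominus> x" and "f = \<one> \<ominus> y"
  have ef: "e \<in> carrier A" "f \<in> carrier A" using c by (auto simp: e_def f_def alg_closed)
  have xy: "x \<otimes> y = \<one>" using monoid.Units_r_inv[OF monoid_A x] by (simp add: y_def)
  have "e \<otimes> f = \<one> \<ominus> x \<ominus> y \<oplus> x \<otimes> y"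
    unfolding e_def f_def using c one_closed monoid.r_one[OF monoid_A c(1)] by algebra
  then have "e \<otimes> f \<ominus> e = f"
    unfolding xy e_def f_def using c one_closed by algebra
  then have "alg_norm A f \<le> alg_norm A (e \<otimes> f) + alg_norm A e"
    using norm_triangle[of "e \<otimes> f" "\<ominus> e"] ef by (simp add: norm_uminus alg_minus_eq alg_closed)
  also have "alg_norm A (e \<otimes> f) \<le> alg_norm A e * alg_norm A f"
    by (intro norm_submult ef)
  also have "\<dots> \<le> (1/2) * alg_norm A f"
    using nx ef by (intro mult_right_mono norm_nonneg) (auto simp: e_def)
  finally show ?thesis by (simp add: e_def f_def y_def)
qed

lemma norm_one_minus_conj_le:
  assumes g: "g \<in> Units A" and x: "x \<in> carrier A"
  shows "alg_norm A (\<one> \<ominus> g \<otimes> x \<otimes> inv g) \<le> alg_norm A g * alg_norm A (\<one> \<ominus> x) * alg_norm A (inv g)"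
proof -
  have c: "g \<in> carrier A" "inv g \<in> carrier A"
    using monoid.Units_closed[OF monoid_A g] monoid.Units_inv_closed[OF monoid_A g] by auto
  have "\<one> \<ominus> g \<otimes> x \<otimes> inv g = g \<otimes> (\<one> \<ominus> x) \<otimes> inv g"
    using c x monoid.Units_r_inv[OF monoid_A g] by (simp add: alg_simps)
  then have "alg_norm A (\<one> \<ominus> g \<otimes> x \<otimes> inv g) \<le> alg_norm A (g \<otimes> (\<one> \<ominus> x)) * alg_norm A (inv g)"
    using norm_submult[of "g \<otimes> (\<one> \<ominus> x)" "inv g"] c x by (simp add: alg_closed)
  also have "\<dots> \<le> alg_norm A g * alg_norm A (\<one> \<ominus> x) * alg_norm A (inv g)"
    using c x by (intro mult_right_mono norm_submult norm_nonneg) (auto simp: alg_closed)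
  finally show ?thesis .
qed

lemma norm_one_minus_quotient_le:
  assumes x: "x \<in> carrier A" and y: "y \<in> Units A"
  shows "alg_norm A (\<one> \<ominus> x \<otimes> inv y) \<le> alg_norm A (x \<ominus> y) * alg_norm A (inv y)"
proof -
  have c: "y \<in> carrier A" "inv y \<in> carrier A"
    using monoid.Units_closed[OF monoid_A y] monoid.Units_inv_closed[OF monoid_A y] by auto
  have "\<one> \<ominus> x \<otimes> inv y = \<ominus> ((x \<ominus> y) \<otimes> inv y)"
    using c x monoid.Units_r_inv[OF monoid_A y] by (simp add: alg_simps)
  then show ?thesis
    using norm_submult[of "x \<ominus> y" "inv y"] c x by (simp add: norm_uminus alg_closed)
qed

text \<open>An approximate right inverse \<open>z\<close> controls the true inverse, which is
  \<open>z \<otimes> q\<close>. Writing it as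
  \<open>z \<ominus> z \<otimes> (\<one> \<ominus> q)\<close> avoids the norm of the unit.\<close>

lemma norm_inv_le:
  assumes x: "x \<in> Units A" and z: "z \<in> Units A" and n: "alg_norm A (\<one> \<ominus> x \<otimes> z) \<le> 1/2"
  shows "alg_norm A (inv x) \<le> 2 * alg_norm A z"
proof -
  define q where "q = inv (x \<otimes> z)"
  have xz: "x \<otimes> z \<in> Units A" by (rule monoid.Units_m_closed[OF monoid_A x z])
  have c: "x \<in> carrier A" "z \<in> carrier A" "q \<in> carrier A" "inv x \<in> carrier A" "inv z \<in> carrier A"
    using x z xz monoid.Units_closed[OF monoid_A] monoid.Units_inv_closed[OF monoid_A]
    by (auto simp: q_def)
  have "inv x = z \<otimes> q"
    unfolding q_def inv_mult_Units[OF monoid_A x z]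
    using c monoid.Units_cancel(2)[OF monoid_A z c(4)] by simp
  also have "\<dots> = z \<ominus> z \<otimes> (\<one> \<ominus> q)"
    using c one_closed monoid.r_one[OF monoid_A c(2)] by algebra
  finally have "alg_norm A (inv x) \<le> alg_norm A z + alg_norm A (z \<otimes> (\<one> \<ominus> q))"
    using norm_triangle[of z "\<ominus> (z \<otimes> (\<one> \<ominus> q))"] c by (simp add: norm_uminus alg_minus_eq alg_closed)
  also have "alg_norm A (z \<otimes> (\<one> \<ominus> q)) \<le> alg_norm A z * alg_norm A (\<one> \<ominus> q)"
    using c by (intro norm_submult) (auto simp: alg_closed)
  also have "\<dots> \<le> alg_norm A z * 1"
    using norm_one_minus_inv_le[OF xz n] n c by (intro mult_left_mono norm_nonneg) (auto simp: q_def)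
  finally show ?thesis by simp
qed

end

section \<open>Asymptotic calculus of the trace logarithm\<close>

locale bounded_trace_sequence =
  fixes A :: "nat \<Rightarrow> ('a, 'r) normed_alg_scheme" and \<tau> :: "nat \<Rightarrow> 'a \<Rightarrow> complex"
  assumes tracial: "\<And>n. unital_tracial_banach_algebra (A n) (\<tau> n)"
    and trace_bounded: "bdd_above (range (\<lambda>n. functional_norm (A n) (\<tau> n)))"
begin

sublocale alg: unital_tracial_banach_algebra "A n" "\<tau> n" for n
  by (rule tracial)

text \<open>Invertibility is required at every index, so that identities between units hold for all
  n and only statements about logarithms are restricted to large n.\<close>

definition near_one :: "(nat \<Rightarrow> 'a) \<Rightarrow> bool" where
  "near_one x \<longleftrightarrow> (\<forall>n. x n \<in> Units (A n)) \<and>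
    (\<lambda>n. alg_norm (A n) (\<one>\<^bsub>A n\<^esub> \<ominus>\<^bsub>A n\<^esub> x n)) \<longlonglongrightarrow> 0"

text \<open>For a sequence of multiplicative defects this is the sequence whose class is a value of
  \<open>asymp_cocycle\<close>.\<close>

definition trace_log :: "(nat \<Rightarrow> 'a) \<Rightarrow> nat \<Rightarrow> complex" where
  "trace_log x n = 1 / (2 * of_real pi * \<i>) * \<tau> n (alg_log (A n) (x n))"

lemma Units_imp_carrier: "x \<in> Units (A n) \<Longrightarrow> x \<in> carrier (A n)"
  by (rule monoid.Units_closed[OF alg.monoid_A])

lemma near_one_Units: "near_one x \<Longrightarrow> x n \<in> Units (A n)"
  by (simp add: near_one_def)

lemma near_one_carrier: "near_one x \<Longrightarrow> x n \<in> carrier (A n)"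
  by (rule Units_imp_carrier[OF near_one_Units])

lemma near_one_eventually:
  assumes "near_one x" "0 < e"
  shows "eventually (\<lambda>n. alg_norm (A n) (\<one>\<^bsub>A n\<^esub> \<ominus>\<^bsub>A n\<^esub> x n) < e) sequentially"
  using assms by (auto simp: near_one_def intro: order_tendstoD)

lemma near_oneI:
  assumes "\<And>n. x n \<in> Units (A n)"
    and "\<And>n. alg_norm (A n) (\<one>\<^bsub>A n\<^esub> \<ominus>\<^bsub>A n\<^esub> x n) \<le> f n" and "f \<longlonglongrightarrow> 0"
  shows "near_one x"
  unfolding near_one_def
proof (intro conjI allI assms(1) Lim_null_comparison[OF always_eventually assms(3)])
  fix n
  have "\<one>\<^bsub>A n\<^esub> \<ominus>\<^bsub>A n\<^esub> x n \<in> carrier (A n)"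
    using Units_imp_carrier[OF assms(1)] by (simp add: alg.alg_closed)
  then show "norm (alg_norm (A n) (\<one>\<^bsub>A n\<^esub> \<ominus>\<^bsub>A n\<^esub> x n)) \<le> f n"
    using assms(2)[of n] alg.norm_nonneg[of _ n] by simp
qed

lemma near_one_conj:
  assumes x: "near_one x" and g: "\<And>n. g n \<in> Units (A n)"
    and bg: "Bseq (\<lambda>n. alg_norm (A n) (g n))" and bi: "Bseq (\<lambda>n. alg_norm (A n) (inv\<^bsub>A n\<^esub> (g n)))"
  shows "near_one (\<lambda>n. g n \<otimes>\<^bsub>A n\<^esub> x n \<otimes>\<^bsub>A n\<^esub> inv\<^bsub>A n\<^esub> (g n))"
proof (rule near_oneI)
  show "g n \<otimes>\<^bsub>A n\<^esub> x n \<otimes>\<^bsub>A n\<^esub> inv\<^bsub>A n\<^esub> (g n) \<in> Units (A n)" for n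
    using g near_one_Units[OF x]
    by (intro monoid.Units_m_closed[OF alg.monoid_A] monoid.Units_inv_Units[OF alg.monoid_A])
  show "alg_norm (A n) (\<one>\<^bsub>A n\<^esub> \<ominus>\<^bsub>A n\<^esub> g n \<otimes>\<^bsub>A n\<^esub> x n \<otimes>\<^bsub>A n\<^esub> inv\<^bsub>A n\<^esub> (g n))
      \<le> alg_norm (A n) (g n) * alg_norm (A n) (\<one>\<^bsub>A n\<^esub> \<ominus>\<^bsub>A n\<^esub> x n) * alg_norm (A n) (inv\<^bsub>A n\<^esub> (g n))" for n
    by (rule alg.norm_one_minus_conj_le[OF g near_one_carrier[OF x]])
  have "(\<lambda>n. alg_norm (A n) (\<one>\<^bsub>A n\<^esub> \<ominus>\<^bsub>A n\<^esub> x n)) \<longlonglongrightarrow> 0"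
    using x by (simp add: near_one_def)
  then have "Zfun (\<lambda>n. alg_norm (A n) (\<one>\<^bsub>A n\<^esub> \<ominus>\<^bsub>A n\<^esub> x n)) sequentially"
    by (simp add: tendsto_Zfun_iff)
  then have "Zfun (\<lambda>n. alg_norm (A n) (g n) * alg_norm (A n) (\<one>\<^bsub>A n\<^esub> \<ominus>\<^bsub>A n\<^esub> x n)
      * alg_norm (A n) (inv\<^bsub>A n\<^esub> (g n))) sequentially"
    by (intro bounded_bilinear.Zfun_prod_Bfun[OF bounded_bilinear_mult _ bi]
        bounded_bilinear.Bfun_prod_Zfun[OF bounded_bilinear_mult bg])
  then show "(\<lambda>n. alg_norm (A n) (g n) * alg_norm (A n) (\<one>\<^bsub>A n\<^esub> \<ominus>\<^bsub>A n\<^esub> x n)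
      * alg_norm (A n) (inv\<^bsub>A n\<^esub> (g n))) \<longlonglongrightarrow> 0"
    by (simp add: tendsto_Zfun_iff)
qed

text \<open>The common source of the multiplicative defects and of the comparison units
  \<open>Y\<close> in the final proof.\<close>

lemma near_one_quotient:
  assumes x: "\<And>n. x n \<in> Units (A n)" and y: "\<And>n. y n \<in> Units (A n)"
    and d: "(\<lambda>n. alg_norm (A n) (x n \<ominus>\<^bsub>A n\<^esub> y n)) \<longlonglongrightarrow> 0"
    and b: "Bseq (\<lambda>n. alg_norm (A n) (inv\<^bsub>A n\<^esub> (y n)))"
  shows "near_one (\<lambda>n. x n \<otimes>\<^bsub>A n\<^esub> inv\<^bsub>A n\<^esub> (y n))"
proof (rule near_oneI)
  show "x n \<otimes>\<^bsub>A n\<^esub> inv\<^bsub>A n\<^esub> (y n) \<in> Units (A n)" for n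
    using x y by (intro monoid.Units_m_closed[OF alg.monoid_A] monoid.Units_inv_Units[OF alg.monoid_A])
  show "alg_norm (A n) (\<one>\<^bsub>A n\<^esub> \<ominus>\<^bsub>A n\<^esub> x n \<otimes>\<^bsub>A n\<^esub> inv\<^bsub>A n\<^esub> (y n))
      \<le> alg_norm (A n) (x n \<ominus>\<^bsub>A n\<^esub> y n) * alg_norm (A n) (inv\<^bsub>A n\<^esub> (y n))" for n
    by (rule alg.norm_one_minus_quotient_le[OF Units_imp_carrier[OF x] y])
  show "(\<lambda>n. alg_norm (A n) (x n \<ominus>\<^bsub>A n\<^esub> y n) * alg_norm (A n) (inv\<^bsub>A n\<^esub> (y n))) \<longlonglongrightarrow> 0"
    using bounded_bilinear.Zfun_prod_Bfun[OF bounded_bilinear_mult _ b] d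
    by (simp add: tendsto_Zfun_iff)
qed

text \<open>Applied to \<rho>(a) with \<rho> of the inverse of a as \<open>z\<close>: inverses in
  the algebras are not bounded by hypothesis.\<close>

lemma Bseq_norm_inv:
  assumes x: "\<And>n. x n \<in> Units (A n)" and z: "\<And>n. z n \<in> Units (A n)"
    and b: "Bseq (\<lambda>n. alg_norm (A n) (z n))" and xz: "near_one (\<lambda>n. x n \<otimes>\<^bsub>A n\<^esub> z n)"
  shows "Bseq (\<lambda>n. alg_norm (A n) (inv\<^bsub>A n\<^esub> (x n)))"
proof (rule Bseq_eventually_mono)
  show "Bseq (\<lambda>n. 2 * alg_norm (A n) (z n))"
    using Bseq_mult[OF Bfun_const b] by simp
  have nn: "0 \<le> alg_norm (A n) (inv\<^bsub>A n\<^esub> (x n))" for n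
    by (intro alg.norm_nonneg monoid.Units_inv_closed[OF alg.monoid_A] x)
  have "eventually (\<lambda>n. alg_norm (A n) (\<one>\<^bsub>A n\<^esub> \<ominus>\<^bsub>A n\<^esub> x n \<otimes>\<^bsub>A n\<^esub> z n) < 1/2) sequentially"
    using near_one_eventually[OF xz, of "1/2"] by simp
  then show "eventually (\<lambda>n. norm (alg_norm (A n) (inv\<^bsub>A n\<^esub> (x n))) \<le> norm (2 * alg_norm (A n) (z n))) sequentially"
  proof eventually_elim
    case (elim n)
    then show ?case
      using alg.norm_inv_le[OF x z, of n] nn[of n] by simp
  qed
qed

text \<open>The uniform bound on the functional norms enters here: it makes the estimate of the
  trace logarithm uniform in n.\<close>

lemma trace_log_tendsto_0:
  assumes x: "near_one x"
  shows "trace_log x \<longlonglongrightarrow> 0"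
proof -
  obtain M where M: "\<And>n. functional_norm (A n) (\<tau> n) \<le> M"
    using trace_bounded by (auto simp: bdd_above_def)
  have lim: "(\<lambda>n. 2 * M * alg_norm (A n) (\<one>\<^bsub>A n\<^esub> \<ominus>\<^bsub>A n\<^esub> x n)) \<longlonglongrightarrow> 0"
    using x by (intro tendsto_mult_right_zero) (simp add: near_one_def)
  have "eventually (\<lambda>n. alg_norm (A n) (\<one>\<^bsub>A n\<^esub> \<ominus>\<^bsub>A n\<^esub> x n) < 1/2) sequentially"
    using near_one_eventually[OF x, of "1/2"] by simp
  then have "eventually (\<lambda>n. norm (\<tau> n (alg_log (A n) (x n)))
      \<le> 2 * M * alg_norm (A n) (\<one>\<^bsub>A n\<^esub> \<ominus>\<^bsub>A n\<^esub> x n)) sequentially"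
  proof eventually_elim
    case (elim n)
    have c: "x n \<in> carrier (A n)" "\<one>\<^bsub>A n\<^esub> \<ominus>\<^bsub>A n\<^esub> x n \<in> carrier (A n)"
      using near_one_carrier[OF x] by (auto simp: alg.alg_closed)
    have "norm (\<tau> n (alg_log (A n) (x n)))
        \<le> 2 * functional_norm (A n) (\<tau> n) * alg_norm (A n) (\<one>\<^bsub>A n\<^esub> \<ominus>\<^bsub>A n\<^esub> x n)"
      using alg.norm_trace_log_le[OF c(1)] elim by simp
    also have "\<dots> \<le> 2 * M * alg_norm (A n) (\<one>\<^bsub>A n\<^esub> \<ominus>\<^bsub>A n\<^esub> x n)"
      using M[of n] by (intro mult_right_mono alg.norm_nonneg c) simp
    finally show ?case .
  qed
  from Lim_null_comparison[OF this lim] have "(\<lambda>n. \<tau> n (alg_log (A n) (x n))) \<longlonglongrightarrow> 0" .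
  then have "(\<lambda>n. 1 / (2 * of_real pi * \<i>) * \<tau> n (alg_log (A n) (x n))) \<longlonglongrightarrow> 0"
    by (rule tendsto_mult_right_zero)
  then show ?thesis
    by (simp add: trace_log_def[abs_def])
qed

lemma trace_log_mult:
  assumes x: "near_one x" and y: "near_one y"
  shows "eventually (\<lambda>n. trace_log (\<lambda>n. x n \<otimes>\<^bsub>A n\<^esub> y n) n = trace_log x n + trace_log y n) sequentially"
proof -
  have "eventually (\<lambda>n. alg_norm (A n) (\<one>\<^bsub>A n\<^esub> \<ominus>\<^bsub>A n\<^esub> x n) < 1/5) sequentially"
      "eventually (\<lambda>n. alg_norm (A n) (\<one>\<^bsub>A n\<^esub> \<ominus>\<^bsub>A n\<^esub> y n) < 1/5) sequentially"
    using near_one_eventually[OF x, of "1/5"] near_one_eventually[OF y, of "1/5"] by auto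
  then show ?thesis
  proof eventually_elim
    case (elim n)
    then show ?case
      using alg.trace_log_mult[OF near_one_carrier[OF x] near_one_carrier[OF y], of n]
      by (simp add: trace_log_def add_divide_distrib)
  qed
qed

lemma trace_log_conj:
  assumes x: "near_one x" and g: "\<And>n. g n \<in> Units (A n)"
    and gx: "near_one (\<lambda>n. g n \<otimes>\<^bsub>A n\<^esub> x n \<otimes>\<^bsub>A n\<^esub> inv\<^bsub>A n\<^esub> (g n))"
  shows "eventually (\<lambda>n. trace_log (\<lambda>n. g n \<otimes>\<^bsub>A n\<^esub> x n \<otimes>\<^bsub>A n\<^esub> inv\<^bsub>A n\<^esub> (g n)) n = trace_log x n) sequentially"
  using near_one_eventually[OF x zero_less_one] near_one_eventually[OF gx zero_less_one]
proof eventually_elim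
  case (elim n)
  then show ?case
    using alg.trace_log_conj[OF g near_one_carrier[OF x], of n] by (simp add: trace_log_def)
qed

lemma Bseq_norm:
  assumes "\<And>n. x n \<in> carrier (A n)" "bdd_above (range (\<lambda>n. alg_norm (A n) (x n)))"
  shows "Bseq (\<lambda>n. alg_norm (A n) (x n))"
proof -
  obtain M where "\<And>n. alg_norm (A n) (x n) \<le> M"
    using assms(2) by (auto simp: bdd_above_def)
  then show ?thesis
    using alg.norm_nonneg[OF assms(1)] by (intro BseqI') simp
qed

end

section \<open>The cocycle and its triviality for perturbed homomorphisms\<close>

theorem theorem3p5:
  fixes G :: "('g, 'm) monoid_scheme"
    and A :: "nat \<Rightarrow> ('a, 'r) normed_alg_scheme"
    and \<tau> :: "nat \<Rightarrow> 'a \<Rightarrow> complex"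
    and \<rho> :: "nat \<Rightarrow> 'g \<Rightarrow> 'a"
  assumes "group G"
    and "\<And>n. unital_tracial_banach_algebra (A n) (\<tau> n)"
    and "bdd_above (range (\<lambda>n. functional_norm (A n) (\<tau> n)))"
    and "\<And>n. \<rho> n \<in> carrier G \<rightarrow> Units (A n)"
    and "\<And>n. \<rho> n \<one>\<^bsub>G\<^esub> = \<one>\<^bsub>A n\<^esub>"
    and "\<And>a b. \<lbrakk>a \<in> carrier G; b \<in> carrier G\<rbrakk> \<Longrightarrow>
          (\<lambda>n. alg_norm (A n) (\<rho> n a \<otimes>\<^bsub>A n\<^esub> \<rho> n b \<ominus>\<^bsub>A n\<^esub> \<rho> n (a \<otimes>\<^bsub>G\<^esub> b))) \<longlonglongrightarrow> 0"
    and "\<And>a. a \<in> carrier G \<Longrightarrow> bdd_above (range (\<lambda>n. alg_norm (A n) (\<rho> n a)))"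
  shows
    "(\<forall>a \<in> carrier G. \<forall>b \<in> carrier G. \<forall>\<^sub>F n in sequentially.
        alg_norm (A n) (mult_defect G (A n) (\<rho> n) a b \<ominus>\<^bsub>A n\<^esub> \<one>\<^bsub>A n\<^esub>) < 1) \<and>
     asymp_cocycle G A \<tau> \<rho> \<in> carrier (Z2 G QC) \<and>
     ((\<exists>\<pi>. (\<forall>n. \<pi> n \<in> hom G (units_of (A n))) \<and>
           (\<forall>a \<in> carrier G. (\<lambda>n. alg_norm (A n) (\<rho> n a \<ominus>\<^bsub>A n\<^esub> \<pi> n a)) \<longlonglongrightarrow> 0)) \<longrightarrow>
      H2_class G QC (asymp_cocycle G A \<tau> \<rho>) = \<one>\<^bsub>H2 G QC\<^esub>)"
proof -
  interpret G: group G by fact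
  interpret S: bounded_trace_sequence A \<tau>
    using assms(2,3) by (rule bounded_trace_sequence.intro)
  have \<rho>U: "\<rho> n a \<in> Units (A n)" if "a \<in> carrier G" for a n
    using assms(4) that by auto
  have \<rho>B: "Bseq (\<lambda>n. alg_norm (A n) (\<rho> n a))" if "a \<in> carrier G" for a
    using S.Units_imp_carrier[OF \<rho>U[OF that]] assms(7)[OF that] by (rule S.Bseq_norm)
  have \<rho>iB: "Bseq (\<lambda>n. alg_norm (A n) (inv\<^bsub>A n\<^esub> (\<rho> n a)))" if a: "a \<in> carrier G" for a
  proof (rule S.Bseq_norm_inv[OF \<rho>U[OF a] \<rho>U[OF G.inv_closed[OF a]] \<rho>B[OF G.inv_closed[OF a]]])
    show "S.near_one (\<lambda>n. \<rho> n a \<otimes>\<^bsub>A n\<^esub> \<rho> n (inv\<^bsub>G\<^esub> a))"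
    proof (rule S.near_oneI)
      show U: "\<rho> n a \<otimes>\<^bsub>A n\<^esub> \<rho> n (inv\<^bsub>G\<^esub> a) \<in> Units (A n)" for n
        by (intro monoid.Units_m_closed[OF S.alg.monoid_A] \<rho>U a G.inv_closed)
      \<comment> \<open>Since \<rho> is unital, the unit is its value at the product of
        \<open>a\<close> with its inverse, so asymptotic multiplicativity applies to this
        pair.\<close>
      show "alg_norm (A n) (\<one>\<^bsub>A n\<^esub> \<ominus>\<^bsub>A n\<^esub> \<rho> n a \<otimes>\<^bsub>A n\<^esub> \<rho> n (inv\<^bsub>G\<^esub> a))
          \<le> alg_norm (A n) (\<rho> n a \<otimes>\<^bsub>A n\<^esub> \<rho> n (inv\<^bsub>G\<^esub> a) \<ominus>\<^bsub>A n\<^esub> \<rho> n (a \<otimes>\<^bsub>G\<^esub> inv\<^bsub>G\<^esub> a))" for n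
        using S.alg.norm_minus_commute[of "\<one>\<^bsub>A n\<^esub>" n] S.Units_imp_carrier[OF U] a
        by (simp add: assms(5) S.alg.alg_closed)
      show "(\<lambda>n. alg_norm (A n) (\<rho> n a \<otimes>\<^bsub>A n\<^esub> \<rho> n (inv\<^bsub>G\<^esub> a) \<ominus>\<^bsub>A n\<^esub> \<rho> n (a \<otimes>\<^bsub>G\<^esub> inv\<^bsub>G\<^esub> a))) \<longlonglongrightarrow> 0"
        using a by (intro assms(6)) auto
    qed
  qed
  define D where "D a b n = \<rho> n a \<otimes>\<^bsub>A n\<^esub> \<rho> n b \<otimes>\<^bsub>A n\<^esub> inv\<^bsub>A n\<^esub> (\<rho> n (a \<otimes>\<^bsub>G\<^esub> b))" for a b n
  have D: "S.near_one (D a b)" if ab: "a \<in> carrier G" "b \<in> carrier G" for a b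
    unfolding D_def
    by (intro S.near_one_quotient monoid.Units_m_closed[OF S.alg.monoid_A] \<rho>U \<rho>iB assms(6) ab G.m_closed)
  have \<omega>: "asymp_cocycle G A \<tau> \<rho> = (\<lambda>(a, b) \<in> carrier G \<times> carrier G. QC_class (S.trace_log (D a b)))"
    by (simp add: asymp_cocycle_def mult_defect_def D_def[abs_def] S.trace_log_def[abs_def])
  note class_closed = QC_class_closed[OF S.trace_log_tendsto_0]
  \<comment> \<open>Additivity holds only from some index on; in \<open>QC\<close> it becomes an
    equality.\<close>
  have class_mult: "QC_class (S.trace_log x) \<otimes>\<^bsub>QC\<^esub> QC_class (S.trace_log y)
      = QC_class (S.trace_log (\<lambda>n. x n \<otimes>\<^bsub>A n\<^esub> y n))"
    if x: "S.near_one x" and y: "S.near_one y" for x y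
  proof -
    note lim = S.trace_log_tendsto_0[OF x] S.trace_log_tendsto_0[OF y]
    have ev: "eventually (\<lambda>n. S.trace_log x n + S.trace_log y n
        = S.trace_log (\<lambda>n. x n \<otimes>\<^bsub>A n\<^esub> y n) n) sequentially"
      using S.trace_log_mult[OF x y] by eventually_elim simp
    have sum: "(\<lambda>n. S.trace_log x n + S.trace_log y n) \<longlonglongrightarrow> 0"
      using tendsto_add[OF lim] by simp
    have "S.trace_log (\<lambda>n. x n \<otimes>\<^bsub>A n\<^esub> y n) \<longlonglongrightarrow> 0"
      by (rule Lim_transform_eventually[OF sum ev])
    then show ?thesis
      unfolding QC_class_mult[OF lim] using QC_class_cong[OF ev sum] by simp
  qed
  have class_conj: "QC_class (S.trace_log (\<lambda>n. g n \<otimes>\<^bsub>A n\<^esub> x n \<otimes>\<^bsub>A n\<^esub> inv\<^bsub>A n\<^esub> (g n)))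
        = QC_class (S.trace_log x)"
      and near_conj: "S.near_one (\<lambda>n. g n \<otimes>\<^bsub>A n\<^esub> x n \<otimes>\<^bsub>A n\<^esub> inv\<^bsub>A n\<^esub> (g n))"
    if x: "S.near_one x" and g: "\<And>n. g n \<in> Units (A n)"
      and bg: "Bseq (\<lambda>n. alg_norm (A n) (g n))" and bi: "Bseq (\<lambda>n. alg_norm (A n) (inv\<^bsub>A n\<^esub> (g n)))"
    for g x
  proof -
    show near: "S.near_one (\<lambda>n. g n \<otimes>\<^bsub>A n\<^esub> x n \<otimes>\<^bsub>A n\<^esub> inv\<^bsub>A n\<^esub> (g n))"
      by (rule S.near_one_conj[OF x g bg bi])
    show "QC_class (S.trace_log (\<lambda>n. g n \<otimes>\<^bsub>A n\<^esub> x n \<otimes>\<^bsub>A n\<^esub> inv\<^bsub>A n\<^esub> (g n))) = QC_class (S.trace_log x)"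
      by (intro QC_class_cong S.trace_log_conj S.trace_log_tendsto_0 x g near)
  qed
  \<comment> \<open>This secures convergence of the logarithm series for all large n.\<close>
  have "\<forall>a \<in> carrier G. \<forall>b \<in> carrier G. \<forall>\<^sub>F n in sequentially.
      alg_norm (A n) (mult_defect G (A n) (\<rho> n) a b \<ominus>\<^bsub>A n\<^esub> \<one>\<^bsub>A n\<^esub>) < 1"
  proof (intro ballI)
    fix a b assume ab: "a \<in> carrier G" "b \<in> carrier G"
    show "\<forall>\<^sub>F n in sequentially. alg_norm (A n) (mult_defect G (A n) (\<rho> n) a b \<ominus>\<^bsub>A n\<^esub> \<one>\<^bsub>A n\<^esub>) < 1"
      using S.near_one_eventually[OF D[OF ab] zero_less_one]
    proof eventually_elim
      case (elim n)
      then show ?case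
        using S.alg.norm_minus_commute[of "D a b n" n "\<one>\<^bsub>A n\<^esub>"] S.near_one_carrier[OF D[OF ab], of n]
        by (simp add: mult_defect_def D_def S.alg.alg_closed)
    qed
  qed
  moreover have "asymp_cocycle G A \<tau> \<rho> \<in> carrier (Z2 G QC)"
  proof -
    have "QC_class (S.trace_log (D a b)) \<otimes>\<^bsub>QC\<^esub> QC_class (S.trace_log (D (a \<otimes>\<^bsub>G\<^esub> b) c))
        = QC_class (S.trace_log (D a (b \<otimes>\<^bsub>G\<^esub> c))) \<otimes>\<^bsub>QC\<^esub> QC_class (S.trace_log (D b c))"
      if abc: "a \<in> carrier G" "b \<in> carrier G" "c \<in> carrier G" for a b c
    proof -
      interpret QC: comm_group QC by (rule comm_group_QC)
      let ?w = "\<lambda>n. \<rho> n a \<otimes>\<^bsub>A n\<^esub> D b c n \<otimes>\<^bsub>A n\<^esub> inv\<^bsub>A n\<^esub> (\<rho> n a)"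
      have m: "a \<otimes>\<^bsub>G\<^esub> b \<in> carrier G" "b \<otimes>\<^bsub>G\<^esub> c \<in> carrier G" "a \<otimes>\<^bsub>G\<^esub> (b \<otimes>\<^bsub>G\<^esub> c) \<in> carrier G"
        using abc by auto
      note w = class_conj[OF D[OF abc(2,3)] \<rho>U \<rho>B \<rho>iB, OF abc(1) abc(1) abc(1)]
        near_conj[OF D[OF abc(2,3)] \<rho>U \<rho>B \<rho>iB, OF abc(1) abc(1) abc(1)]
      \<comment> \<open>Reassociating abc first gives the last inverses on both sides the same
        argument, as the identity for units requires.\<close>
      have "D a b n \<otimes>\<^bsub>A n\<^esub> D (a \<otimes>\<^bsub>G\<^esub> b) c n = ?w n \<otimes>\<^bsub>A n\<^esub> D a (b \<otimes>\<^bsub>G\<^esub> c) n" for n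
        unfolding D_def G.m_assoc[OF abc]
        by (intro monoid.defect_cocycle_identity[OF S.alg.monoid_A] \<rho>U abc m)
      then have "QC_class (S.trace_log (D a b)) \<otimes>\<^bsub>QC\<^esub> QC_class (S.trace_log (D (a \<otimes>\<^bsub>G\<^esub> b) c))
          = QC_class (S.trace_log ?w) \<otimes>\<^bsub>QC\<^esub> QC_class (S.trace_log (D a (b \<otimes>\<^bsub>G\<^esub> c)))"
        using class_mult[OF D[OF abc(1,2)] D[OF m(1) abc(3)]] class_mult[OF w(2) D[OF abc(1) m(2)]]
        by simp
      \<comment> \<open>The conjugation is invisible in the class by \<open>w(1)\<close>;
        commutativity of \<open>QC\<close> then puts the factors in the order of the cocycle
        condition.\<close>
      then show ?thesis
        unfolding w(1) using class_closed[OF D] abc m by (simp add: QC.m_comm)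
    qed
    then show ?thesis
      unfolding \<omega> using class_closed[OF D] by (auto simp: Z2_def)
  qed
  moreover have "H2_class G QC (asymp_cocycle G A \<tau> \<rho>) = \<one>\<^bsub>H2 G QC\<^esub>"
    if \<pi>hom: "\<And>n. \<pi> n \<in> hom G (units_of (A n))"
      and \<pi>lim: "\<And>a. a \<in> carrier G \<Longrightarrow> (\<lambda>n. alg_norm (A n) (\<rho> n a \<ominus>\<^bsub>A n\<^esub> \<pi> n a)) \<longlonglongrightarrow> 0" for \<pi>
  proof -
    interpret QC: comm_group QC by (rule comm_group_QC)
    have hom: "group_hom G (units_of (A n)) (\<pi> n)" for n
      using \<pi>hom G.is_group monoid.units_group[OF S.alg.monoid_A]
      by (simp add: group_hom_def group_hom_axioms_def)
    have \<pi>U: "\<pi> n a \<in> Units (A n)" if "a \<in> carrier G" for a n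
      using group_hom.hom_closed[OF hom that] by (simp add: units_of_carrier)
    have \<pi>mult: "\<pi> n (a \<otimes>\<^bsub>G\<^esub> b) = \<pi> n a \<otimes>\<^bsub>A n\<^esub> \<pi> n b" if "a \<in> carrier G" "b \<in> carrier G" for a b n
      using group_hom.hom_mult[OF hom that] by (simp add: units_of_mult)
    have \<pi>inv: "inv\<^bsub>A n\<^esub> (\<pi> n a) = \<pi> n (inv\<^bsub>G\<^esub> a)" if "a \<in> carrier G" for a n
      using group_hom.hom_inv[OF hom that] monoid.units_of_inv[OF S.alg.monoid_A \<pi>U[OF that]] by simp
    \<comment> \<open>Boundedness of \<pi> is inherited from \<rho>: eventually the two differ by
      less than 1.\<close>
    have \<pi>B: "Bseq (\<lambda>n. alg_norm (A n) (\<pi> n a))" if a: "a \<in> carrier G" for a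
    proof (rule Bseq_eventually_mono)
      show "Bseq (\<lambda>n. alg_norm (A n) (\<rho> n a) + 1)"
        by (intro Bseq_add \<rho>B a)
      have "\<forall>\<^sub>F n in sequentially. alg_norm (A n) (\<rho> n a \<ominus>\<^bsub>A n\<^esub> \<pi> n a) < 1"
        using order_tendstoD(2)[OF \<pi>lim[OF a]] by simp
      then show "\<forall>\<^sub>F n in sequentially. norm (alg_norm (A n) (\<pi> n a)) \<le> norm (alg_norm (A n) (\<rho> n a) + 1)"
      proof eventually_elim
        case (elim n)
        have c: "\<pi> n a \<in> carrier (A n)" "\<rho> n a \<in> carrier (A n)" "\<rho> n a \<ominus>\<^bsub>A n\<^esub> \<pi> n a \<in> carrier (A n)"
          using S.Units_imp_carrier[OF \<pi>U[OF a]] S.Units_imp_carrier[OF \<rho>U[OF a]]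
          by (auto simp: S.alg.alg_closed)
        have "\<pi> n a = \<rho> n a \<oplus>\<^bsub>A n\<^esub> (\<ominus>\<^bsub>A n\<^esub> (\<rho> n a \<ominus>\<^bsub>A n\<^esub> \<pi> n a))"
          using c by (simp add: S.alg.alg_simps)
        then have "alg_norm (A n) (\<pi> n a) \<le> alg_norm (A n) (\<rho> n a) + alg_norm (A n) (\<rho> n a \<ominus>\<^bsub>A n\<^esub> \<pi> n a)"
          using S.alg.norm_triangle[of "\<rho> n a" n "\<ominus>\<^bsub>A n\<^esub> (\<rho> n a \<ominus>\<^bsub>A n\<^esub> \<pi> n a)"] c
          by (simp add: S.alg.norm_uminus S.alg.alg_closed)
        then show ?case
          using elim S.alg.norm_nonneg[OF c(1)] by simp
      qed
    qed
    \<comment> \<open>Inverses of values of a homomorphism are again values of it, so the previous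
      bound covers them.\<close>
    have \<pi>iB: "Bseq (\<lambda>n. alg_norm (A n) (inv\<^bsub>A n\<^esub> (\<pi> n a)))" if "a \<in> carrier G" for a
      using \<pi>B[of "inv\<^bsub>G\<^esub> a"] that by (simp add: \<pi>inv)
    define Y where "Y a n = \<rho> n a \<otimes>\<^bsub>A n\<^esub> inv\<^bsub>A n\<^esub> (\<pi> n a)" for a n
    have Y: "S.near_one (Y a)" if "a \<in> carrier G" for a
      unfolding Y_def by (intro S.near_one_quotient \<rho>U \<pi>U \<pi>lim \<pi>iB that)
    define \<gamma> where "\<gamma> a = QC_class (S.trace_log (Y a))" for a
    have \<gamma>: "\<gamma> a \<in> carrier QC" if "a \<in> carrier G" for a
      unfolding \<gamma>_def by (rule class_closed[OF Y[OF that]])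
    have "QC_class (S.trace_log (D a b)) = \<gamma> a \<otimes>\<^bsub>QC\<^esub> inv\<^bsub>QC\<^esub> \<gamma> (a \<otimes>\<^bsub>G\<^esub> b) \<otimes>\<^bsub>QC\<^esub> \<gamma> b"
      if ab: "a \<in> carrier G" "b \<in> carrier G" for a b
    proof -
      have m: "a \<otimes>\<^bsub>G\<^esub> b \<in> carrier G" using ab by auto
      let ?w = "\<lambda>n. \<pi> n a \<otimes>\<^bsub>A n\<^esub> Y b n \<otimes>\<^bsub>A n\<^esub> inv\<^bsub>A n\<^esub> (\<pi> n a)"
      note w = class_conj[OF Y[OF ab(2)] \<pi>U \<pi>B \<pi>iB, OF ab(1) ab(1) ab(1)]
        near_conj[OF Y[OF ab(2)] \<pi>U \<pi>B \<pi>iB, OF ab(1) ab(1) ab(1)]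
      have "D a b n \<otimes>\<^bsub>A n\<^esub> Y (a \<otimes>\<^bsub>G\<^esub> b) n = Y a n \<otimes>\<^bsub>A n\<^esub> ?w n" for n
        unfolding D_def Y_def \<pi>mult[OF ab]
        by (intro monoid.defect_coboundary_identity[OF S.alg.monoid_A] \<rho>U \<pi>U ab m)
      then have "QC_class (S.trace_log (D a b)) \<otimes>\<^bsub>QC\<^esub> \<gamma> (a \<otimes>\<^bsub>G\<^esub> b) = \<gamma> a \<otimes>\<^bsub>QC\<^esub> \<gamma> b"
        using class_mult[OF D[OF ab] Y[OF m]] class_mult[OF Y[OF ab(1)] w(2)]
        by (simp add: \<gamma>_def w(1))
      moreover have "QC_class (S.trace_log (D a b)) \<in> carrier QC"
        by (rule class_closed[OF D[OF ab]])
      ultimately have "QC_class (S.trace_log (D a b)) = \<gamma> a \<otimes>\<^bsub>QC\<^esub> \<gamma> b \<otimes>\<^bsub>QC\<^esub> inv\<^bsub>QC\<^esub> \<gamma> (a \<otimes>\<^bsub>G\<^esub> b)"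
        using \<gamma>[OF ab(1)] \<gamma>[OF ab(2)] \<gamma>[OF m] by (metis QC.inv_solve_right QC.m_closed)
      then show ?thesis
        using \<gamma>[OF ab(1)] \<gamma>[OF ab(2)] \<gamma>[OF m] by (simp add: QC.m_ac)
    qed
    then have "asymp_cocycle G A \<tau> \<rho> = coboundary G QC \<gamma>"
      unfolding \<omega> coboundary_def by (auto intro!: restrict_ext)
    then show ?thesis
      using H2_class_coboundary[OF G.is_group comm_group_QC] \<gamma> by auto
  qed
  ultimately show ?thesis by blast
qed

end
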